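(* For every natural number $s \geq 3$ there exists a constant $c_s$ such that for every natural number $n$, \[ r(Q_n, K_s) \leq c_s\, 2^n. \]
   Context: The hypercube $Q_n$ is the graph on vertex set $\{0,1\}^n$ in which two vertices are adjacent if and only if they differ in exactly one coordinate. For graphs $G,H$, the Ramsey number $r(G,H)$ is the smallest natural number $N$ such that every red/blue coloring of the edges of the complete graph $K_N$ contains a red copy of $G$ or a blue copy of $H$. $K_s$ is the complete graph on $s$ vertices. (Equivalently, $r(Q_n,K_s)$ is the least $N$ such that every graph on $N$ vertices contains $Q_n$ as a subgraph or has an independent set of size $s$.) *)

theory Defs
  imports Complex_Main
begin

definition simple_graph_on :: "nat \<Rightarrow> (nat \<Rightarrow> nat \<Rightarrow> bool) \<Rightarrow> bool" where
  "simple_graph_on N E \<longleftrightarrow> (\<forall>u<N. \<forall>v<N. E u v \<longleftrightarrow> E v u) \<and> (\<forall>v<N. \<not> E v v)"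

text \<open>Hypercube Q_n: vertices are the subsets of {0..<n} (i.e. 0/1 vectors of
  length n via indicator), adjacent iff they differ in exactly one coordinate.\<close>

definition cube_vertices :: "nat \<Rightarrow> nat set set" where
  "cube_vertices n = Pow {0..<n}"

definition cube_adj :: "nat set \<Rightarrow> nat set \<Rightarrow> bool" where
  "cube_adj A B \<longleftrightarrow> card ((A - B) \<union> (B - A)) = 1"

definition contains_cube :: "nat \<Rightarrow> (nat \<Rightarrow> nat \<Rightarrow> bool) \<Rightarrow> nat \<Rightarrow> bool" where
  "contains_cube N E n \<longleftrightarrow>
     (\<exists>f. inj_on f (cube_vertices n) \<and> f ` cube_vertices n \<subseteq> {0..<N} \<and>
          (\<forall>A\<in>cube_vertices n. \<forall>B\<in>cube_vertices n. cube_adj A B \<longrightarrow> E (f A) (f B)))"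

definition has_indep_set :: "nat \<Rightarrow> (nat \<Rightarrow> nat \<Rightarrow> bool) \<Rightarrow> nat \<Rightarrow> bool" where
  "has_indep_set N E s \<longleftrightarrow>
     (\<exists>I. I \<subseteq> {0..<N} \<and> card I = s \<and> (\<forall>u\<in>I. \<forall>v\<in>I. \<not> E u v))"

definition ramsey_cube_clique :: "nat \<Rightarrow> nat \<Rightarrow> nat" where
  "ramsey_cube_clique n s =
     (LEAST N. \<forall>E. simple_graph_on N E \<longrightarrow> contains_cube N E n \<or> has_indep_set N E s)"

end

theory Submission
  imports Defs "HOL-Library.Ramsey" "HOL-Library.Disjoint_Sets"
begin

text \<open>
  Call the non-edges blue; there is no blue clique of size \<open>s\<close>. Among \<open>K\<^sub>R 2\<^sup>n\<close> vertices, where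
  \<open>R = s - 1\<close>, extract disjoint vertex sets of sizes \<open>K\<^bsub>R-1\<^esub> 2\<^bsup>n-c\<^esup>\<close> with smaller blue clique
  number, the largest ones (smallest \<open>c\<close>) first. Neighbourhoods have smaller clique number, so
  a vertex of an extracted set has at most \<open>O(2\<^bsup>n-c\<^esup>)\<close> blue neighbours in this set and the later ones.
  Recursively this gives a tree of vertex sets of depth \<open>R\<close> whose leaves are single vertices.
  A set of size \<open>K\<^sub>r 2\<^bsup>n-c\<^esup>\<close> is to host a subcube in which the first \<open>c\<close> coordinates are fixed.
  Go through the codimensions in increasing order and assign to each subcube not yet covered an
  unused child of the set hosting its surroundings, as long as it has small blue density to all
  sets already assigned across an edge of the cube. If some vertex of the cube remained
  uncovered, then all children of some set would be used or too dense to one of its neighbours. But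
  the excluded children are few: the fraction excluded across the coordinate \<open>b\<close> decays geometrically
  in the distance from \<open>b\<close> to the codimension of a common ancestor. Hence the whole cube is
  covered by single vertices, and adjacent ones have blue density less than 1, so they are
  joined by an edge.
\<close>

text \<open>A lexicographically maximal family: many elements of small weight take precedence over
  everything of larger weight, so it is maximal at every weight simultaneously.\<close>

lemma greedy_family:
  fixes w :: "'b \<Rightarrow> nat"
  assumes fin: "finite U" and S0: "S0 \<subseteq> U" "P S0"
  shows "\<exists>S\<subseteq>U. P S \<and> (\<forall>a\<in>U - S. \<not> P (insert a {z \<in> S. w z \<le> w a}))"
proof -
  define n where "n = Max (insert 0 (w ` U))"
  have wn: "w z \<le> n" if "z \<in> U" for z
    using that fin unfolding n_def by (intro Max_ge) auto
  \<comment> \<open>The base exceeds \<open>card U\<close>, so all elements of weight above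
    \<open>w a\<close> together contribute less to \<open>f\<close> than \<open>a\<close> alone:
    comparing \<open>f\<close> compares families lexicographically by weight.\<close>
  define B where "B = Suc (card U)"
  define f where "f S = (\<Sum>z\<in>S. B ^ (n - w z))" for S
  define \<F> where "\<F> = {S. S \<subseteq> U \<and> P S}"
  have "finite \<F>" "S0 \<in> \<F>"
    using fin S0 by (auto simp: \<F>_def)
  then have "Max (f ` \<F>) \<in> f ` \<F>" and max: "\<And>T. T \<in> \<F> \<Longrightarrow> f T \<le> Max (f ` \<F>)"
    by (auto intro: Max_in)
  then obtain S where S: "S \<in> \<F>" "Max (f ` \<F>) = f S" by auto
  have finS: "finite S" using S fin by (auto simp: \<F>_def intro: finite_subset)
  show ?thesis
  proof (intro exI conjI ballI)
    show "S \<subseteq> U" "P S" using S by (auto simp: \<F>_def)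
    fix a assume a': "a \<in> U - S"
    then have a: "a \<in> U" "a \<notin> S" by auto
    let ?lo = "{z \<in> S. w z \<le> w a}" and ?hi = "{z \<in> S. w z > w a}"
    show "\<not> P (insert a ?lo)"
    proof
      assume "P (insert a ?lo)"
      then have "insert a ?lo \<in> \<F>" using a S by (auto simp: \<F>_def)
      then have "f (insert a ?lo) \<le> f S" using max S by simp
      moreover have "f (insert a ?lo) = B ^ (n - w a) + f ?lo"
        using a finS by (simp add: f_def)
      moreover have "f S = f ?lo + f ?hi"
        unfolding f_def using finS
        by (subst sum.union_disjoint[symmetric]) (auto intro!: sum.cong)
      moreover have "f ?hi < B ^ (n - w a)"
      proof (cases "?hi = {}")
        case True
        show ?thesis unfolding True by (simp add: f_def B_def)
      next
        case False
        then obtain z where "z \<in> U" "w z > w a" using \<open>S \<in> \<F>\<close> by (auto simp: \<F>_def)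
        then have lt: "w a < n" using wn[of z] by simp
        have "f ?hi \<le> (\<Sum>z\<in>?hi. B ^ (n - w a - 1))"
          unfolding f_def by (intro sum_mono power_increasing) (auto simp: B_def)
        also have "\<dots> = card ?hi * B ^ (n - w a - 1)" by simp
        also have "\<dots> \<le> card U * B ^ (n - w a - 1)"
          using S fin by (intro mult_right_mono card_mono) (auto simp: \<F>_def)
        also have "\<dots> < B * B ^ (n - w a - 1)" by (simp add: B_def)
        also have "\<dots> = B ^ (n - w a)"
          using lt by (simp add: Suc_diff_Suc flip: power_Suc)
        finally show ?thesis .
      qed
      ultimately show False by simp
    qed
  qed
qed

section \<open>Blue cliques and blue edge counts\<close>

locale blue_graph =
  fixes V :: "'a set" and blue :: "'a \<Rightarrow> 'a \<Rightarrow> bool"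
  assumes finite_V: "finite V"
    and blue_sym: "blue u v \<Longrightarrow> blue v u"
    and blue_irrefl: "\<not> blue v v"
begin

definition clique_free :: "nat \<Rightarrow> 'a set \<Rightarrow> bool" where
  "clique_free k X \<longleftrightarrow> \<not> (\<exists>C\<subseteq>X. card C = k \<and> (\<forall>u\<in>C. \<forall>v\<in>C. u \<noteq> v \<longrightarrow> blue u v))"

definition edges :: "'a set \<Rightarrow> 'a set \<Rightarrow> nat" where
  "edges X Y = (\<Sum>u\<in>X. card {v \<in> Y. blue u v})"

lemma clique_free_mono: "clique_free k X \<Longrightarrow> Y \<subseteq> X \<Longrightarrow> clique_free k Y"
  unfolding clique_free_def by blast

text \<open>A blue clique among the blue neighbours of \<open>w\<close> could be enlarged by
  \<open>w\<close>.\<close>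

lemma clique_free_nbhd:
  assumes "clique_free (Suc k) X" "w \<in> X" "X \<subseteq> V"
  shows "clique_free k {v \<in> X. blue w v}"
  unfolding clique_free_def
proof (intro notI, elim exE conjE)
  fix C assume C: "C \<subseteq> {v \<in> X. blue w v}" "card C = k" "\<forall>u\<in>C. \<forall>v\<in>C. u \<noteq> v \<longrightarrow> blue u v"
  have "C \<subseteq> V" using C(1) assms(3) by auto
  then have "finite C" using finite_V by (rule finite_subset)
  moreover have "w \<notin> C" using C blue_irrefl by auto
  ultimately have "card (insert w C) = Suc k" using C by simp
  moreover have "insert w C \<subseteq> X" using C assms by auto
  moreover have "\<forall>u\<in>insert w C. \<forall>v\<in>insert w C. u \<noteq> v \<longrightarrow> blue u v"
    using C blue_sym by auto
  ultimately show False using assms(1) unfolding clique_free_def by blast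
qed

lemma clique_free_independent:
  assumes "\<forall>u\<in>X. \<forall>v\<in>X. \<not> blue u v"
  shows "clique_free (Suc (Suc k)) X"
  unfolding clique_free_def
proof (intro notI, elim exE conjE)
  fix C assume C: "C \<subseteq> X" "card C = Suc (Suc k)" "\<forall>u\<in>C. \<forall>v\<in>C. u \<noteq> v \<longrightarrow> blue u v"
  then obtain u v where "u \<in> C" "v \<in> C" "u \<noteq> v"
    by (metis card_Suc_eq insert_iff)
  then show False using C assms by blast
qed

lemma edges_sym:
  assumes "finite X" "finite Y"
  shows "edges X Y = edges Y X"
proof -
  have "edges X Y = (\<Sum>u\<in>X. \<Sum>v\<in>Y. of_bool (blue u v))"
    using assms unfolding edges_def by (intro sum.cong) (auto simp: Int_def)
  also have "\<dots> = (\<Sum>v\<in>Y. \<Sum>u\<in>X. of_bool (blue u v))" by (rule sum.swap)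
  also have "\<dots> = (\<Sum>v\<in>Y. \<Sum>u\<in>X. of_bool (blue v u))"
    using blue_sym by (intro sum.cong) (auto simp: of_bool_def)
  also have "\<dots> = edges Y X"
    using assms unfolding edges_def by (intro sum.cong) (auto simp: Int_def)
  finally show ?thesis .
qed

lemma sum_edges_le:
  assumes "finite F" "finite U" "\<And>a. a \<in> F \<Longrightarrow> Y a \<subseteq> U"
    and "disjoint_family_on Y F"
  shows "(\<Sum>a\<in>F. edges Z (Y a)) \<le> edges Z U"
proof -
  have "(\<Sum>a\<in>F. edges Z (Y a)) = (\<Sum>u\<in>Z. \<Sum>a\<in>F. card {v \<in> Y a. blue u v})"
    unfolding edges_def by (rule sum.swap)
  also have "\<dots> \<le> edges Z U"
    unfolding edges_def
  proof (intro sum_mono)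
    fix u
    have "(\<Sum>a\<in>F. card {v \<in> Y a. blue u v}) = card (\<Union>a\<in>F. {v \<in> Y a. blue u v})"
    proof (intro card_UN_disjoint[symmetric])
      show "\<forall>a\<in>F. finite {v \<in> Y a. blue u v}"
        using assms(3) by (auto intro: finite_subset[OF _ assms(2)])
      show "\<forall>a\<in>F. \<forall>b\<in>F. a \<noteq> b \<longrightarrow> {v \<in> Y a. blue u v} \<inter> {v \<in> Y b. blue u v} = {}"
        using assms(4) unfolding disjoint_family_on_def by blast
    qed (fact assms(1))
    also have "\<dots> \<le> card {v \<in> U. blue u v}"
      using assms by (intro card_mono) auto
    finally show "(\<Sum>a\<in>F. card {v \<in> Y a. blue u v}) \<le> card {v \<in> U. blue u v}" .
  qed
  finally show ?thesis .
qed

text \<open>Double counting: \<open>D\<close> bounds the average blue degree from \<open>Z\<close>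
  into \<open>U\<close>, and each of the disjoint sets \<open>Y a\<close> uses up at least
  \<open>t * card (Y a)\<close> of it.\<close>

lemma dense_mass_le:
  fixes t D :: real
  assumes "finite F" "finite U" "\<And>a. a \<in> F \<Longrightarrow> Y a \<subseteq> U" "disjoint_family_on Y F"
    and dense: "\<And>a. a \<in> F \<Longrightarrow> edges Z (Y a) \<ge> t * card Z * card (Y a)"
    and U: "edges Z U \<le> D * card Z" and Z: "card Z > 0"
  shows "t * (\<Sum>a\<in>F. real (card (Y a))) \<le> D"
proof -
  have "card Z * (t * (\<Sum>a\<in>F. real (card (Y a)))) = (\<Sum>a\<in>F. t * card Z * card (Y a))"
    by (simp add: sum_distrib_left mult_ac)
  also have "\<dots> \<le> (\<Sum>a\<in>F. real (edges Z (Y a)))"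
    by (intro sum_mono dense)
  also have "\<dots> \<le> real (edges Z U)"
    using sum_edges_le[OF assms(1-4), of Z] by (simp flip: of_nat_sum)
  also have "\<dots> \<le> card Z * D" using U by (simp add: mult.commute)
  finally show ?thesis using Z by simp
qed

end

section \<open>Splitting clique-free vertex sets\<close>

text \<open>\<open>K_independent\<close> is how Ramsey's theorem enters: it holds once
  \<open>K (Suc r)\<close> is at least twice the Ramsey number for blue cliques of size
  \<open>r + 2\<close> against independent sets of size \<open>K r\<close>.\<close>

locale node_sizes = blue_graph V blue for V :: "'a set" and blue +
  fixes n :: nat and K :: "nat \<Rightarrow> nat"
  assumes K_0: "K 0 = 1"
    and K_pos: "K r > 0"
    and K_independent: "X \<subseteq> V \<Longrightarrow> clique_free (Suc (Suc r)) X \<Longrightarrow> K (Suc r) \<le> 2 * card X \<Longrightarrow>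
      \<exists>Y\<subseteq>X. card Y = K r \<and> (\<forall>u\<in>Y. \<forall>v\<in>Y. \<not> blue u v)"
begin

text \<open>A node of rank \<open>r\<close> and depth \<open>c\<close> is meant to host a subcube of codimension \<open>c\<close>. As a
  nonempty set is never free of cliques of size 1, rank 0 plays a special role: these nodes are
  single vertices, hosting single vertices of the cube.\<close>

definition node :: "nat \<Rightarrow> nat \<Rightarrow> 'a set \<Rightarrow> bool" where
  "node r c X \<longleftrightarrow> X \<subseteq> V \<and> c \<le> n \<and> card X = K r * 2 ^ (n - c) \<and>
     (if r = 0 then c = n else clique_free (Suc r) X)"

text \<open>Children are extracted largest first. The degree bound holds because the neighbourhood of a
  vertex has smaller clique number: were it large within what remains, a larger child could have
  been extracted from it.\<close>

definition is_split :: "nat \<Rightarrow> nat \<Rightarrow> 'a set \<Rightarrow> (nat \<times> 'a set) set \<Rightarrow> bool" where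
  "is_split r c X F \<longleftrightarrow> finite F \<and> (\<forall>a\<in>F. c \<le> fst a \<and> snd a \<subseteq> X \<and> node r (fst a) (snd a)) \<and>
     disjoint_family_on snd F \<and> card X \<le> 2 * (\<Sum>a\<in>F. card (snd a)) \<and>
     (\<forall>a\<in>F. c < fst a \<longrightarrow> (\<forall>w\<in>snd a.
        card {v \<in> \<Union>(snd ` {a'\<in>F. fst a \<le> fst a'}). blue w v} \<le> 2 * K r * 2 ^ (n - fst a)))"

lemma node_finite: "node r c X \<Longrightarrow> finite X"
  using finite_V by (auto simp: node_def intro: finite_subset)

lemma node_card_pos: "node r c X \<Longrightarrow> card X > 0"
  by (auto simp: node_def K_pos)

text \<open>For \<open>r = 0\<close> the node is independent and falls apart into singletons.
  Otherwise a family that is maximal at every depth works: maximality at depth \<open>n\<close>,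
  with \<open>K_independent\<close>, shows that half of \<open>X\<close> is covered; maximality one
  level above a child yields the degree bound.\<close>

lemma split_exists:
  assumes X: "node (Suc r) c X"
  shows "\<exists>F. is_split r c X F"
proof (cases "r = 0")
  case True
  define F where "F = (\<lambda>v. (n, {v})) ` X"
  have fin: "finite X" by (rule node_finite[OF X])
  have indep: "\<not> blue u v" if "u \<in> X" "v \<in> X" for u v
  proof
    assume "blue u v"
    then have "u \<noteq> v" "blue v u" using blue_irrefl blue_sym by auto
    then have "\<exists>C\<subseteq>X. card C = 2 \<and> (\<forall>u\<in>C. \<forall>v\<in>C. u \<noteq> v \<longrightarrow> blue u v)"
      using that \<open>blue u v\<close> by (intro exI[of _ "{u, v}"]) auto
    then show False using X True by (simp add: node_def clique_free_def numeral_2_eq_2)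
  qed
  have "is_split r c X F"
    unfolding is_split_def
  proof (intro conjI ballI impI)
    show "finite F" using fin by (simp add: F_def)
    show "disjoint_family_on snd F" by (auto simp: F_def disjoint_family_on_def)
    have "(\<Sum>a\<in>F. card (snd a)) = card X"
      unfolding F_def by (subst sum.reindex) (auto simp: inj_on_def)
    then show "card X \<le> 2 * (\<Sum>a\<in>F. card (snd a))" by simp
  next
    fix a assume a: "a \<in> F"
    then show "c \<le> fst a" "snd a \<subseteq> X" "node r (fst a) (snd a)"
      using X True by (auto simp: F_def node_def K_0)
    fix w assume "w \<in> snd a"
    then have "{v \<in> \<Union>(snd ` {a'\<in>F. fst a \<le> fst a'}). blue w v} = {}"
      using a indep by (auto simp: F_def)
    then show "card {v \<in> \<Union>(snd ` {a'\<in>F. fst a \<le> fst a'}). blue w v} \<le> 2 * K r * 2 ^ (n - fst a)"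
      by (simp only: card.empty)
  qed
  then show ?thesis ..
next
  case False
  have fin: "finite X" by (rule node_finite[OF X])
  have XV: "X \<subseteq> V" and cn: "c \<le> n" and cardX: "card X = K (Suc r) * 2 ^ (n - c)"
    and free: "clique_free (Suc (Suc r)) X"
    using X by (auto simp: node_def)
  define P where "P F \<longleftrightarrow> (\<forall>a\<in>F. node r (fst a) (snd a)) \<and> disjoint_family_on snd F"
    for F :: "(nat \<times> 'a set) set"
  have "finite ({c..n} \<times> Pow X)" "{} \<subseteq> {c..n} \<times> Pow X" "P {}"
    using fin by (auto simp: P_def disjoint_family_on_def)
  from greedy_family[where P = P and w = fst, OF this]
  obtain F where F: "F \<subseteq> {c..n} \<times> Pow X" "P F"
    and max: "\<forall>a\<in>{c..n} \<times> Pow X - F. \<not> P (insert a {z \<in> F. fst z \<le> fst a})"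
    by (elim exE conjE)
  have finF: "finite F" using F fin by (auto intro: finite_subset)
  have F_mem: "c \<le> fst a" "fst a \<le> n" "snd a \<subseteq> X" if "a \<in> F" for a
  proof -
    have "a \<in> {c..n} \<times> Pow X" using F(1) that by blast
    then show "c \<le> fst a" "fst a \<le> n" "snd a \<subseteq> X" by auto
  qed
  define rest where "rest k = X - \<Union>(snd ` {a \<in> F. fst a \<le> k})" for k
  \<comment> \<open>Maximality in usable form: such a set \<open>Z\<close> would contain a further
    child of depth \<open>k\<close>, disjoint from all children of depth at most
    \<open>k\<close>.\<close>
  have no_more: False
    if k: "k \<in> {c..n}" and Z: "Z \<subseteq> rest k" "clique_free (Suc r) Z" "card Z \<ge> K r * 2 ^ (n - k)" for k Z
  proof -
    obtain Y where Y: "Y \<subseteq> Z" "card Y = K r * 2 ^ (n - k)"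
      using obtain_subset_with_card_n[OF Z(3)] by metis
    have nodeY: "node r k Y"
      using Y Z k False XV clique_free_mono[OF Z(2) Y(1)] by (auto simp: node_def rest_def)
    have disj: "snd a \<inter> Y = {}" if "a \<in> F" "fst a \<le> k" for a
      using that Y Z by (auto simp: rest_def)
    have "Y \<noteq> {}" using node_card_pos[OF nodeY] by auto
    then have "(k, Y) \<notin> F" using disj[of "(k, Y)"] by auto
    moreover have "P (insert (k, Y) {z \<in> F. fst z \<le> k})"
    proof -
      have "snd a \<inter> snd b = {}" if "a \<in> F" "b \<in> F" "a \<noteq> b" for a b
        using that F(2) unfolding P_def disjoint_family_on_def by blast
      then have "disjoint_family_on snd (insert (k, Y) {z \<in> F. fst z \<le> k})"
        unfolding disjoint_family_on_def using disj
        by (metis (no_types, lifting) inf_commute insertE mem_Collect_eq snd_conv)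
      then show ?thesis using F(2) nodeY by (auto simp: P_def)
    qed
    moreover have "(k, Y) \<in> {c..n} \<times> Pow X"
      using k Y Z by (auto simp: rest_def)
    ultimately show False using bspec[OF max, of "(k, Y)"] by simp
  qed
  have sumF: "(\<Sum>a\<in>F. card (snd a)) = card (\<Union>(snd ` F))"
    using F finF by (intro card_UN_disjoint[symmetric])
      (auto simp: P_def disjoint_family_on_def intro: node_finite)
  have "is_split r c X F"
    unfolding is_split_def
  proof (intro conjI ballI impI)
    show "finite F" by (rule finF)
    show "disjoint_family_on snd F" using F by (simp add: P_def)
    show "card X \<le> 2 * (\<Sum>a\<in>F. card (snd a))"
    proof (rule ccontr)
      assume "\<not> ?thesis"
      then have lt: "2 * card (\<Union>(snd ` F)) < card X" by (simp add: sumF)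
      have "{a \<in> F. fst a \<le> n} = F" using F_mem by auto
      then have rest: "rest n = X - \<Union>(snd ` F)" by (simp add: rest_def)
      have "\<Union>(snd ` F) \<subseteq> X" using F_mem by blast
      then have "card (rest n) = card X - card (\<Union>(snd ` F))"
        unfolding rest using fin by (intro card_Diff_subset) (auto intro: finite_subset)
      then have "card X \<le> 2 * card (rest n)" using lt by simp
      moreover have "K (Suc r) \<le> card X" using cardX by simp
      ultimately have "K (Suc r) \<le> 2 * card (rest n)" by simp
      moreover have "rest n \<subseteq> X" by (simp add: rest_def)
      ultimately obtain Y where "Y \<subseteq> rest n" "card Y = K r" "\<forall>u\<in>Y. \<forall>v\<in>Y. \<not> blue u v"
        using K_independent[of "rest n" r] clique_free_mono[OF free] XV by (metis order_trans)
      \<comment> \<open>Single vertices are cliques of size 1, so independence excludes cliques of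
        size \<open>Suc r\<close> only because \<open>r > 0\<close>.\<close>
      moreover obtain r' where "r = Suc r'" using False not0_implies_Suc by blast
      ultimately show False
        using no_more[of n Y] clique_free_independent[of Y r'] cn by simp
    qed
  next
    fix a assume a: "a \<in> F"
    then show "c \<le> fst a" "snd a \<subseteq> X" "node r (fst a) (snd a)"
      using F_mem F(2) by (auto simp: P_def)
    fix w assume "c < fst a" and w: "w \<in> snd a"
    \<comment> \<open>Maximality is used one level above \<open>a\<close>, where nodes are twice as
      large; this is the factor 2 in the degree bound. The assumption \<open>c < fst a\<close> makes
      \<open>k\<close> an admissible depth.\<close>
    define k where "k = fst a - 1"
    have fa: "fst a = Suc k" "k \<in> {c..n}" using F_mem[OF a] \<open>c < fst a\<close> by (auto simp: k_def)
    let ?U = "\<Union>(snd ` {a'\<in>F. fst a \<le> fst a'})"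
    have sub: "?U \<subseteq> rest k"
    proof
      fix v assume "v \<in> ?U"
      then obtain a' where a': "a' \<in> F" "fst a \<le> fst a'" "v \<in> snd a'" by auto
      have "v \<notin> snd b" if "b \<in> F" "fst b \<le> k" for b
        using that a' fa F(2) by (force simp: P_def disjoint_family_on_def)
      then show "v \<in> rest k" using a' F_mem(3)[OF a'(1)] by (auto simp: rest_def)
    qed
    have "{v \<in> ?U. blue w v} \<subseteq> {v \<in> X. blue w v}" using F_mem(3) by blast
    then have "clique_free (Suc r) {v \<in> ?U. blue w v}"
      using clique_free_nbhd[OF free _ XV, of w] w F_mem(3)[OF a] clique_free_mono by blast
    moreover have "{v \<in> ?U. blue w v} \<subseteq> rest k" using sub by blast
    ultimately have "\<not> card {v \<in> ?U. blue w v} \<ge> K r * 2 ^ (n - k)"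
      using no_more fa by blast
    moreover have "n - k = Suc (n - fst a)" using fa F_mem[OF a] by auto
    ultimately show "card {v \<in> ?U. blue w v} \<le> 2 * K r * 2 ^ (n - fst a)"
      by simp
  qed
  then show ?thesis ..
qed

definition split :: "nat \<Rightarrow> nat \<Rightarrow> 'a set \<Rightarrow> (nat \<times> 'a set) set" where
  "split r c X = (SOME F. is_split r c X F)"

lemma is_split_split: "node (Suc r) c X \<Longrightarrow> is_split r c X (split r c X)"
  unfolding split_def by (rule someI_ex[OF split_exists])

end

section \<open>Assigning nodes to subcubes\<close>

definition flip :: "nat \<Rightarrow> nat set \<Rightarrow> nat set" where
  "flip b x = (x - {b}) \<union> ({b} - x)"

lemma flip_flip [simp]: "flip b (flip b x) = x"
  by (auto simp: flip_def)

lemma flip_subset: "b < n \<Longrightarrow> x \<subseteq> {..<n} \<Longrightarrow> flip b x \<subseteq> {..<n}"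
  by (auto simp: flip_def)

text \<open>The subcube of a piece consists of all \<open>x\<close> that agree with \<open>prefix\<close> on the first \<open>depth\<close>
  coordinates; \<open>body\<close> is the vertex set into which it is going to be embedded.\<close>

datatype 'a piece = Piece (depth: nat) (prefix: "nat set") (rank: nat) (body: "'a set")

definition covers :: "'a piece \<Rightarrow> nat set \<Rightarrow> bool" where
  "covers P x \<longleftrightarrow> x \<inter> {..<depth P} = prefix P"

lemma covers_flip: "depth P \<le> b \<Longrightarrow> covers P (flip b x) \<longleftrightarrow> covers P x"
proof -
  assume "depth P \<le> b"
  then have "flip b x \<inter> {..<depth P} = x \<inter> {..<depth P}" by (auto simp: flip_def)
  then show ?thesis by (simp add: covers_def)
qed

lemma not_covers_flip: "b < depth P \<Longrightarrow> covers P x \<Longrightarrow> \<not> covers P (flip b x)"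
  by (auto simp: flip_def covers_def set_eq_iff)

lemma covers_cong:
  assumes "x \<inter> {..<c} = y \<inter> {..<c}" "depth P \<le> c"
  shows "covers P x \<longleftrightarrow> covers P y"
proof -
  have "x \<inter> {..<depth P} = (x \<inter> {..<c}) \<inter> {..<depth P}" for x using assms(2) by auto
  then have "x \<inter> {..<depth P} = y \<inter> {..<depth P}" using assms(1) by metis
  then show ?thesis by (simp add: covers_def)
qed

lemma flip_cong:
  assumes "x \<inter> {..<c} = y \<inter> {..<c}"
  shows "flip b x \<inter> {..<c} = flip b y \<inter> {..<c}"
  using assms by (auto simp: flip_def set_eq_iff)

lemma covers_trans:
  assumes "covers Q (prefix P)" "depth Q \<le> depth P" "covers P x"
  shows "covers Q x"
proof -
  have "prefix P \<inter> {..<depth P} = x \<inter> {..<depth P}" using assms(3) by (auto simp: covers_def)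
  then show ?thesis using covers_cong assms by metis
qed

definition subcube :: "nat \<Rightarrow> 'a piece \<Rightarrow> nat set set" where
  "subcube n P = {x. x \<subseteq> {..<n} \<and> covers P x}"

lemma finite_subcube: "finite (subcube n P)"
  by (rule finite_subset[of _ "Pow {..<n}"]) (auto simp: subcube_def)

lemma card_subcube:
  assumes "prefix P \<subseteq> {..<depth P}" "depth P \<le> n"
  shows "card (subcube n P) = 2 ^ (n - depth P)"
proof -
  have "bij_betw (\<lambda>y. prefix P \<union> y) (Pow {depth P..<n}) (subcube n P)"
  proof (rule bij_betw_byWitness[where f' = "\<lambda>x. x \<inter> {depth P..<n}"])
    show "\<forall>y\<in>Pow {depth P..<n}. (prefix P \<union> y) \<inter> {depth P..<n} = y"
      using assms by auto
    show "\<forall>x\<in>subcube n P. prefix P \<union> x \<inter> {depth P..<n} = x"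
    proof
      fix x assume "x \<in> subcube n P"
      then have "x \<subseteq> {..<n}" "x \<inter> {..<depth P} = prefix P"
        by (auto simp: subcube_def covers_def)
      moreover have "x = x \<inter> {..<depth P} \<union> x \<inter> {depth P..<n}" if "x \<subseteq> {..<n}"
        using that by auto
      ultimately show "prefix P \<union> x \<inter> {depth P..<n} = x" by metis
    qed
    show "(\<union>) (prefix P) ` Pow {depth P..<n} \<subseteq> subcube n P"
    proof
      fix x assume "x \<in> (\<union>) (prefix P) ` Pow {depth P..<n}"
      then obtain y where y: "y \<subseteq> {depth P..<n}" "x = prefix P \<union> y" by auto
      then have "x \<inter> {..<depth P} = prefix P" using assms(1) by auto
      moreover have "x \<subseteq> {..<n}" using y assms by auto
      ultimately show "x \<in> subcube n P" by (auto simp: subcube_def covers_def)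
    qed
    show "(\<lambda>x. x \<inter> {depth P..<n}) ` subcube n P \<subseteq> Pow {depth P..<n}" by auto
  qed
  from bij_betw_same_card[OF this] show ?thesis by (simp add: card_Pow)
qed

text \<open>The constants make the final count work: \<open>8 * K r \<le> K (Suc r)\<close> limits
  used children to 1/8 of a node, and the bound on \<open>\<delta>\<close> limits excluded ones to
  1/4, less than the half covered by all children. By \<open>1 / 2 \<le> \<xi> ^ (2 * R)\<close>,
  densities decay no faster in \<open>\<beta>\<close> than subcubes shrink.\<close>

locale cube_embedding = node_sizes V blue n K
  for V :: "'a set" and blue :: "'a \<Rightarrow> 'a \<Rightarrow> bool" and n :: nat and K :: "nat \<Rightarrow> nat" +
  fixes R :: nat and \<delta> \<xi> :: real
  assumes \<xi>: "0 < \<xi>" "\<xi> < 1" "1 / 2 \<le> \<xi> ^ (2 * R)"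
    and \<delta>: "0 < \<delta>" "\<delta> \<le> 1" "4 * (R + 1)\<^sup>2 * \<delta> \<le> 1 - \<xi>"
    and K_step: "r < R \<Longrightarrow> 8 * K r \<le> K (Suc r)" "r < R \<Longrightarrow> 2 * K r \<le> \<delta> ^ (2 * R) * K (Suc r)"
    and node_V: "node R 0 V"
begin

text \<open>The density allowed between two pieces that meet across coordinate \<open>b\<close>: \<open>m\<close> is the sum of
  their ranks and \<open>\<beta> = b - depth G\<close> for a common ancestor \<open>G\<close>. Each refinement of one of the
  two pieces relaxes the bound by the factor \<open>1 / (\<delta> \<xi>\<^sup>\<beta>)\<close>, so that at most a
  \<open>\<delta> \<xi>\<^sup>\<beta>\<close> fraction of the possible refinements is excluded, which is summable over \<open>\<beta>\<close>;
  for two single vertices (\<open>m = 0\<close>) a density of at most 1/2 means that there is no edge.\<close>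

definition \<tau> :: "nat \<Rightarrow> nat \<Rightarrow> real" where
  "\<tau> m \<beta> = (\<delta> * \<xi> ^ \<beta>) ^ m / 2"

definition root :: "'a piece" where
  "root = Piece 0 {} R V"

definition sparse :: "nat \<Rightarrow> nat \<Rightarrow> 'a piece \<Rightarrow> 'a piece \<Rightarrow> bool" where
  "sparse m \<beta> P Q \<longleftrightarrow> edges (body P) (body Q) \<le> \<tau> m \<beta> * card (body P) * card (body Q)"

text \<open>The last clause concerns pieces that both fix coordinate \<open>b\<close> and meet
  across it. As \<open>depth G \<le> b\<close>, covering \<open>x\<close> and covering
  \<open>flip b x\<close> are the same for \<open>G\<close>, so the clause is symmetric in
  \<open>P\<close> and \<open>Q\<close>. Which common ancestor \<open>G\<close> serves is left
  open.\<close>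

definition valid :: "'a piece set \<Rightarrow> bool" where
  "valid \<sigma> \<longleftrightarrow> finite \<sigma> \<and> root \<in> \<sigma> \<and>
     (\<forall>P\<in>\<sigma>. node (rank P) (depth P) (body P) \<and> rank P \<le> R \<and> prefix P \<subseteq> {..<depth P}) \<and>
     (\<forall>P\<in>\<sigma>. P = root \<or> (\<exists>Q\<in>\<sigma>. rank Q = Suc (rank P) \<and> covers Q (prefix P) \<and>
        (depth P, body P) \<in> split (rank P) (depth Q) (body Q))) \<and>
     (\<forall>P\<in>\<sigma>. \<forall>Q\<in>\<sigma>. rank P = rank Q \<longrightarrow> P = Q \<or> body P \<inter> body Q = {} \<and> (\<forall>x. \<not> (covers P x \<and> covers Q x))) \<and>
     (\<forall>P\<in>\<sigma>. \<forall>Q\<in>\<sigma>. \<forall>b x. covers P x \<longrightarrow> covers Q (flip b x) \<longrightarrow> b < depth P \<longrightarrow> b < depth Q \<longrightarrow>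
        (\<exists>G\<in>\<sigma>. depth G \<le> b \<and> covers G x \<and> sparse (rank P + rank Q) (b - depth G) P Q))"

lemma \<tau>_pos: "\<tau> m \<beta> > 0"
  using \<xi> \<delta> by (simp add: \<tau>_def)

lemma \<tau>_Suc: "\<tau> (Suc m) \<beta> = \<tau> m \<beta> * (\<delta> * \<xi> ^ \<beta>)"
  by (simp add: \<tau>_def)

section \<open>Structure of a valid assignment\<close>

context
  fixes \<sigma> assumes valid: "valid \<sigma>"
begin

lemma finite_assignment: "finite \<sigma>"
  and root_in: "root \<in> \<sigma>"
  using valid by (auto simp: valid_def)

lemma
  node_all: "\<forall>P\<in>\<sigma>. node (rank P) (depth P) (body P) \<and> rank P \<le> R \<and> prefix P \<subseteq> {..<depth P}"
  and parent_all: "\<forall>P\<in>\<sigma>. P = root \<or> (\<exists>Q\<in>\<sigma>. rank Q = Suc (rank P) \<and> covers Q (prefix P) \<and>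
        (depth P, body P) \<in> split (rank P) (depth Q) (body Q))"
  and unique_all: "\<forall>P\<in>\<sigma>. \<forall>Q\<in>\<sigma>. rank P = rank Q \<longrightarrow>
        P = Q \<or> body P \<inter> body Q = {} \<and> (\<forall>x. \<not> (covers P x \<and> covers Q x))"
  and sparse_all: "\<forall>P\<in>\<sigma>. \<forall>Q\<in>\<sigma>. \<forall>b x. covers P x \<longrightarrow> covers Q (flip b x) \<longrightarrow>
        b < depth P \<longrightarrow> b < depth Q \<longrightarrow>
        (\<exists>G\<in>\<sigma>. depth G \<le> b \<and> covers G x \<and> sparse (rank P + rank Q) (b - depth G) P Q)"
  using valid unfolding valid_def by - (elim conjE, assumption)+

lemma piece_node:
  assumes "P \<in> \<sigma>"
  shows "node (rank P) (depth P) (body P)" "rank P \<le> R" "prefix P \<subseteq> {..<depth P}"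
    "depth P \<le> n" "finite (body P)" "card (body P) > 0"
proof -
  show node: "node (rank P) (depth P) (body P)" and "rank P \<le> R" "prefix P \<subseteq> {..<depth P}"
    using node_all assms by auto
  show "finite (body P)" "card (body P) > 0"
    using node_finite[OF node] node_card_pos[OF node] by auto
  show "depth P \<le> n" using node by (simp add: node_def)
qed

lemma piece_parent:
  assumes "P \<in> \<sigma>" "rank P < R"
  obtains Q where "Q \<in> \<sigma>" "rank Q = Suc (rank P)" "depth Q \<le> depth P"
    "(depth P, body P) \<in> split (rank P) (depth Q) (body Q)" "body P \<subseteq> body Q"
    "\<forall>x. covers P x \<longrightarrow> covers Q x"
proof -
  have "P \<noteq> root" using assms by (auto simp: root_def)
  then obtain Q where Q: "Q \<in> \<sigma>" "rank Q = Suc (rank P)" "covers Q (prefix P)"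
    "(depth P, body P) \<in> split (rank P) (depth Q) (body Q)"
    using parent_all assms by blast
  have "is_split (rank P) (depth Q) (body Q) (split (rank P) (depth Q) (body Q))"
    using is_split_split piece_node(1)[OF Q(1)] Q(2) by simp
  then have sub: "depth Q \<le> depth P" "body P \<subseteq> body Q"
    using Q(4) unfolding is_split_def by force+
  show thesis
    using that[OF Q(1,2) sub(1) Q(4) sub(2)] covers_trans[OF Q(3) sub(1)] by blast
qed

lemma piece_unique:
  assumes "P \<in> \<sigma>" "Q \<in> \<sigma>" "rank P = rank Q"
  shows "covers P x \<Longrightarrow> covers Q x \<Longrightarrow> P = Q"
    and "body P \<inter> body Q \<noteq> {} \<Longrightarrow> P = Q"
  using unique_all assms by blast+

lemma piece_sparse:
  assumes "P \<in> \<sigma>" "Q \<in> \<sigma>" "covers P x" "covers Q (flip b x)" "b < depth P" "b < depth Q"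
  obtains G where "G \<in> \<sigma>" "depth G \<le> b" "covers G x" "sparse (rank P + rank Q) (b - depth G) P Q"
  using sparse_all assms by blast

lemma piece_ancestor:
  assumes "P \<in> \<sigma>" "rank P \<le> k" "k \<le> R"
  shows "\<exists>Q\<in>\<sigma>. rank Q = k \<and> depth Q \<le> depth P \<and> body P \<subseteq> body Q \<and> (\<forall>x. covers P x \<longrightarrow> covers Q x)"
  using assms(2,3)
proof (induction k rule: dec_induct)
  case base
  then show ?case using assms(1) by auto
next
  case (step k)
  then obtain Q where Q: "Q \<in> \<sigma>" "rank Q = k" "depth Q \<le> depth P" "body P \<subseteq> body Q"
    "\<forall>x. covers P x \<longrightarrow> covers Q x" by auto
  have "rank Q < R" using Q(2) step by simp
  from piece_parent[OF Q(1) this] obtain Q' where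
    "Q' \<in> \<sigma>" "rank Q' = Suc (rank Q)" "depth Q' \<le> depth Q" "body Q \<subseteq> body Q'"
    "\<forall>x. covers Q x \<longrightarrow> covers Q' x"
    by metis
  then show ?case using Q by (intro bexI[of _ Q']) auto
qed

text \<open>Pieces covering the same \<open>x\<close> have distinct ranks, all in
  \<open>{..R}\<close>.\<close>

lemma card_chain: "card {P \<in> \<sigma>. covers P x} \<le> R + 1"
proof -
  have "card {P \<in> \<sigma>. covers P x} \<le> card {..R}"
    using piece_node(2) piece_unique(1)
    by (intro card_inj_on_le[where f = rank]) (auto simp: inj_on_def)
  then show ?thesis by simp
qed

section \<open>Children excluded from an extension, and the extension step\<close>

context
  fixes X r F
  assumes X: "X \<in> \<sigma>" "rank X = Suc r" and F_def: "F = split r (depth X) (body X)"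
begin

lemma split_F: "is_split r (depth X) (body X) F"
  using is_split_split piece_node(1)[OF X(1)] X(2) F_def by simp

lemma r_less: "r < R"
  using piece_node(2)[OF X(1)] X(2) by simp

lemma F_props:
  "finite F" "disjoint_family_on snd F" "card (body X) \<le> 2 * (\<Sum>a\<in>F. card (snd a))"
  "a \<in> F \<Longrightarrow> depth X \<le> fst a" "a \<in> F \<Longrightarrow> snd a \<subseteq> body X" "a \<in> F \<Longrightarrow> node r (fst a) (snd a)"
  using split_F by (auto simp: is_split_def)

text \<open>A piece of rank \<open>r\<close> meeting a child of \<open>X\<close> has
  \<open>X\<close> as its parent and that child as its body. Body sizes are \<open>K r\<close> times
  subcube sizes, and the subcubes of these pieces are disjoint inside that of
  \<open>X\<close>.\<close>

lemma used_mass: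
  "(\<Sum>a | a \<in> F \<and> (\<exists>P\<in>\<sigma>. rank P = r \<and> body P \<inter> snd a \<noteq> {}). card (snd a)) \<le> K r * 2 ^ (n - depth X)"
proof -
  define Ps where "Ps = {P \<in> \<sigma>. rank P = r \<and> subcube n P \<subseteq> subcube n X}"
  have fin: "finite Ps" using finite_assignment by (simp add: Ps_def)
  have "{a \<in> F. \<exists>P\<in>\<sigma>. rank P = r \<and> body P \<inter> snd a \<noteq> {}} \<subseteq> (\<lambda>P. (depth P, body P)) ` Ps"
  proof
    fix a assume "a \<in> {a \<in> F. \<exists>P\<in>\<sigma>. rank P = r \<and> body P \<inter> snd a \<noteq> {}}"
    then obtain P where a: "a \<in> F" and P: "P \<in> \<sigma>" "rank P = r" "body P \<inter> snd a \<noteq> {}" by auto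
    have "rank P < R" using P(2) r_less by simp
    obtain Q where Q: "Q \<in> \<sigma>" "rank Q = Suc (rank P)" "depth Q \<le> depth P"
      "(depth P, body P) \<in> split (rank P) (depth Q) (body Q)" "body P \<subseteq> body Q"
      "\<forall>x. covers P x \<longrightarrow> covers Q x"
      by (rule piece_parent[OF P(1) \<open>rank P < R\<close>])
    have "body Q \<inter> body X \<noteq> {}" using Q(5) P(3) F_props(5)[OF a] by blast
    then have "Q = X" using piece_unique(2)[OF Q(1) X(1)] Q(2) P(2) X(2) by simp
    then have "(depth P, body P) \<in> F" using Q(4) P(2) F_def by simp
    then have "(depth P, body P) = a"
      using F_props(2) a P(3) unfolding disjoint_family_on_def by fastforce
    moreover have "P \<in> Ps" using P Q(6) \<open>Q = X\<close> by (auto simp: Ps_def subcube_def)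
    ultimately show "a \<in> (\<lambda>P. (depth P, body P)) ` Ps" by auto
  qed
  then have "(\<Sum>a | a \<in> F \<and> (\<exists>P\<in>\<sigma>. rank P = r \<and> body P \<inter> snd a \<noteq> {}). card (snd a))
      \<le> (\<Sum>a\<in>(\<lambda>P. (depth P, body P)) ` Ps. card (snd a))"
    using fin by (intro sum_mono2) auto
  also have "\<dots> \<le> (\<Sum>P\<in>Ps. card (body P))"
    using sum_image_le[OF fin, of "\<lambda>a. card (snd a)" "\<lambda>P. (depth P, body P)"] by simp
  also have "\<dots> = (\<Sum>P\<in>Ps. K r * card (subcube n P))"
  proof (intro sum.cong refl)
    fix P assume "P \<in> Ps"
    then have "P \<in> \<sigma>" "rank P = r" by (auto simp: Ps_def)
    then show "card (body P) = K r * card (subcube n P)"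
      using piece_node[of P] card_subcube[of P n] by (simp add: node_def)
  qed
  also have "\<dots> = K r * card (\<Union>P\<in>Ps. subcube n P)"
    using fin finite_subcube piece_unique(1)
    by (subst card_UN_disjoint) (auto simp: sum_distrib_left Ps_def subcube_def)
  also have "\<dots> \<le> K r * card (subcube n X)"
    using finite_subcube by (intro mult_left_mono card_mono) (auto simp: Ps_def)
  also have "card (subcube n X) = 2 ^ (n - depth X)"
    using piece_node[OF X(1)] by (intro card_subcube)
  finally show ?thesis .
qed

text \<open>An excluded child is too dense to \<open>Z\<close> for every candidate \<open>G\<close>,
  so one well-chosen \<open>G\<close> bounds their mass. It is \<open>X\<close> itself if
  \<open>depth X \<le> b\<close>, and otherwise the ancestor that witnesses sparsity between
  \<open>X\<close> and \<open>Z\<close>.\<close>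

lemma bad_mass:
  assumes x: "covers X x" and uncovered: "\<And>P. P \<in> \<sigma> \<Longrightarrow> rank P = r \<Longrightarrow> \<not> covers P x"
    and Z: "Z \<in> \<sigma>" "covers Z (flip b x)" "b < depth Z"
  shows "(\<Sum>a | a \<in> F \<and> depth Z \<le> fst a \<and> (\<forall>G\<in>\<sigma>. depth G \<le> b \<longrightarrow> covers G x \<longrightarrow>
            \<tau> (r + rank Z) (b - depth G) * card (body Z) * card (snd a) \<le> edges (body Z) (snd a)).
            real (card (snd a)))
      \<le> card (body X) * (\<Sum>G | G \<in> \<sigma> \<and> covers G x \<and> depth G \<le> b. \<delta> * \<xi> ^ (b - depth G))"
    (is "sum _ ?Bad \<le> _")
proof -
  let ?m = "r + rank Z"
  have "\<exists>G\<in>\<sigma>. depth G \<le> b \<and> covers G x \<and>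
    (\<Sum>a\<in>?Bad. real (card (snd a))) \<le> card (body X) * (\<delta> * \<xi> ^ (b - depth G))"
  proof (cases "depth X \<le> b")
    case True
    \<comment> \<open>\<open>Z\<close> lies in a child \<open>Y\<close> of \<open>X\<close> assigned earlier, whose degrees into the children of
      at least its own depth are bounded by the split.\<close>
    define \<beta> where "\<beta> = b - depth X"
    have Xflip: "covers X (flip b x)" using covers_flip[OF True] x by simp
    \<comment> \<open>Otherwise \<open>Z\<close> would be an ancestor of \<open>X\<close>, or
      \<open>X\<close> itself, and so no deeper than \<open>X\<close>, although it fixes coordinate
      \<open>b\<close>.\<close>
    have "rank Z \<le> r"
    proof (rule ccontr)
      assume "\<not> rank Z \<le> r"
      then have "rank X \<le> rank Z" using X(2) by simp
      from piece_ancestor[OF X(1) this piece_node(2)[OF Z(1)]] obtain Q where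
        Q: "Q \<in> \<sigma>" "rank Q = rank Z" "depth Q \<le> depth X" "\<forall>y. covers X y \<longrightarrow> covers Q y"
        by blast
      then have "Q = Z" using piece_unique(1)[OF Q(1) Z(1) Q(2), of "flip b x"] Q(4) Xflip Z(2) by simp
      then show False using Q(3) Z(3) True by simp
    qed
    from piece_ancestor[OF Z(1) this less_imp_le[OF r_less]] obtain Y where
      Y: "Y \<in> \<sigma>" "rank Y = r" "depth Y \<le> depth Z" "body Z \<subseteq> body Y"
        "\<forall>y. covers Z y \<longrightarrow> covers Y y"
      by blast
    have Yflip: "covers Y (flip b x)" using Y(5) Z(2) by simp
    \<comment> \<open>If \<open>Y\<close> did not fix coordinate \<open>b\<close>, it would cover
      \<open>x\<close> too. In particular \<open>Y\<close> is strictly deeper than \<open>X\<close>,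
      as the degree bound of the split requires.\<close>
    have bY: "b < depth Y"
    proof (rule ccontr)
      assume "\<not> b < depth Y"
      then have "covers Y x" using covers_flip[of Y b x] Yflip by simp
      then show False using uncovered Y by simp
    qed
    have "rank Y < R" using Y(2) r_less by simp
    obtain Q where Q: "Q \<in> \<sigma>" "rank Q = Suc (rank Y)" "depth Q \<le> depth Y"
      "(depth Y, body Y) \<in> split (rank Y) (depth Q) (body Q)" "body Y \<subseteq> body Q"
      "\<forall>x. covers Y x \<longrightarrow> covers Q x"
      by (rule piece_parent[OF Y(1) \<open>rank Y < R\<close>])
    have "Q = X" using piece_unique(1)[OF Q(1) X(1), of "flip b x"] Q(2) X(2) Y(2) Q(6) Yflip Xflip by simp
    then have YF: "(depth Y, body Y) \<in> F" using Q(4) Y(2) F_def by simp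
    define U where "U = \<Union>(snd ` {a\<in>F. depth Y \<le> fst a})"
    have deg: "card {v \<in> U. blue w v} \<le> 2 * K r * 2 ^ (n - depth Y)" if "w \<in> body Y" for w
      using split_F YF bY True that unfolding is_split_def U_def by fastforce
    \<comment> \<open>As \<open>b < depth Y\<close>, the factor 2 of the degree bound is absorbed by
      passing from depth \<open>depth Y\<close> to \<open>b\<close>.\<close>
    have "2 * 2 ^ (n - depth Y) \<le> (2::nat) ^ (n - b)"
      using bY piece_node(4)[OF Y(1)] by (subst power_Suc[symmetric], intro power_increasing) auto
    then have deg': "card {v \<in> U. blue w v} \<le> K r * 2 ^ (n - b)" if "w \<in> body Y" for w
    proof -
      have "card {v \<in> U. blue w v} \<le> K r * (2 * 2 ^ (n - depth Y))"
        using deg[OF that] by (simp add: mult_ac)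
      also have "\<dots> \<le> K r * 2 ^ (n - b)"
        by (intro mult_le_mono2) fact
      finally show ?thesis .
    qed
    have "edges (body Z) U \<le> card (body Z) * (K r * 2 ^ (n - b))"
      unfolding edges_def using sum_bounded_above[of "body Z" "\<lambda>u. card {v \<in> U. blue u v}"] deg' Y(4)
      by auto
    from of_nat_mono[OF this, where 'a = real]
    have eU: "real (edges (body Z) U) \<le> (real (K r) * 2 ^ (n - b)) * real (card (body Z))"
      by (simp add: mult_ac)
    have disj: "disjoint_family_on snd ?Bad"
      using F_props(2) by (rule disjoint_family_on_mono[rotated]) auto
    have le: "\<tau> ?m \<beta> * (\<Sum>a\<in>?Bad. real (card (snd a))) \<le> real (K r) * 2 ^ (n - b)"
    proof (rule dense_mass_le[OF _ _ _ disj _ eU])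
      show "finite ?Bad" using F_props(1) by simp
      have "U \<subseteq> body X" using F_props(5) unfolding U_def by blast
      then show "finite U" using piece_node(5)[OF X(1)] by (rule finite_subset)
      show "snd a \<subseteq> U" if "a \<in> ?Bad" for a using that Y(3) by (auto simp: U_def)
      show "\<tau> ?m \<beta> * card (body Z) * card (snd a) \<le> edges (body Z) (snd a)" if "a \<in> ?Bad" for a
        using that X(1) True x by (auto simp: \<beta>_def)
      show "card (body Z) > 0" by (rule piece_node(6)[OF Z(1)])
    qed
    have base: "0 < \<delta> * \<xi> ^ \<beta>" "\<delta> * \<xi> ^ \<beta> \<le> 1"
      using \<xi> \<delta> by (auto intro!: mult_le_one power_le_one)
    \<comment> \<open>\<open>X\<close> is larger than \<open>K (Suc r) * 2 ^ (n - b)\<close> by the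
      factor \<open>2 ^ \<beta>\<close>, which pays for the powers of \<open>\<xi>\<close>; the
      growth of \<open>K\<close> pays for those of \<open>\<delta>\<close>. The exponent
      \<open>Suc ?m\<close> is at most \<open>2 * R\<close> because
      \<open>rank Z \<le> r < R\<close>.\<close>
    have "real (K r) * 2 ^ (n - b) \<le> card (body X) * \<tau> (Suc ?m) \<beta>"
    proof -
      have "(1 / 2) ^ \<beta> \<le> (\<xi> ^ (2 * R)) ^ \<beta>"
        using \<xi>(3) by (intro power_mono) auto
      then have "\<delta> ^ (2 * R) * (1 / 2) ^ \<beta> \<le> \<delta> ^ (2 * R) * (\<xi> ^ (2 * R)) ^ \<beta>"
        using \<delta> by (intro mult_left_mono) auto
      also have "\<dots> = (\<delta> * \<xi> ^ \<beta>) ^ (2 * R)"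
        by (simp add: power_mult_distrib mult.commute flip: power_mult)
      also have "\<dots> \<le> (\<delta> * \<xi> ^ \<beta>) ^ Suc ?m"
        using base \<open>rank Z \<le> r\<close> r_less by (intro power_decreasing) auto
      finally have 1: "\<delta> ^ (2 * R) * (1 / 2) ^ \<beta> \<le> 2 * \<tau> (Suc ?m) \<beta>" by (simp add: \<tau>_def)
      have "b \<le> n" using bY piece_node(4)[OF Y(1)] by simp
      then have "n - depth X = \<beta> + (n - b)" using True by (simp add: \<beta>_def)
      then have cardX: "card (body X) = K (Suc r) * 2 ^ \<beta> * 2 ^ (n - b)"
        using piece_node(1)[OF X(1)] X(2) by (simp add: node_def power_add)
      have "2 * K r \<le> \<delta> ^ (2 * R) * K (Suc r)" by (rule K_step(2)[OF r_less])
      also have "\<dots> = (\<delta> ^ (2 * R) * (1 / 2) ^ \<beta>) * (K (Suc r) * 2 ^ \<beta>)"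
        by (simp add: power_divide)
      also have "\<dots> \<le> 2 * \<tau> (Suc ?m) \<beta> * (K (Suc r) * 2 ^ \<beta>)"
        using 1 by (intro mult_right_mono) auto
      finally have "K r \<le> \<tau> (Suc ?m) \<beta> * (K (Suc r) * 2 ^ \<beta>)" by simp
      then have "real (K r) * 2 ^ (n - b) \<le> \<tau> (Suc ?m) \<beta> * (K (Suc r) * 2 ^ \<beta>) * 2 ^ (n - b)"
        by (intro mult_right_mono) auto
      then show ?thesis by (simp add: cardX mult_ac)
    qed
    with le have "\<tau> ?m \<beta> * (\<Sum>a\<in>?Bad. real (card (snd a))) \<le> \<tau> ?m \<beta> * (card (body X) * (\<delta> * \<xi> ^ \<beta>))"
      by (simp add: \<tau>_Suc mult_ac)
    then have "(\<Sum>a\<in>?Bad. real (card (snd a))) \<le> card (body X) * (\<delta> * \<xi> ^ \<beta>)"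
      using \<tau>_pos mult_le_cancel_left_pos by blast
    then show ?thesis using X(1) True x by (auto simp: \<beta>_def)
  next
    case False
    \<comment> \<open>\<open>X\<close> and \<open>Z\<close> are already sparse to each other, so few children of \<open>X\<close> are much denser.\<close>
    then have "b < depth X" by simp
    obtain G where "G \<in> \<sigma>" "depth G \<le> b" "covers G x" "sparse (rank X + rank Z) (b - depth G) X Z"
      by (rule piece_sparse[OF X(1) Z(1) x Z(2) \<open>b < depth X\<close> Z(3)])
    then have G: "G \<in> \<sigma>" "depth G \<le> b" "covers G x" "sparse (Suc ?m) (b - depth G) X Z"
      using X(2) by simp_all
    define \<beta> where "\<beta> = b - depth G"
    have eX: "edges (body Z) (body X) \<le> (\<tau> (Suc ?m) \<beta> * card (body X)) * card (body Z)"
      using G(4) edges_sym piece_node(5) X(1) Z(1) by (simp add: sparse_def \<beta>_def)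
    have disj: "disjoint_family_on snd ?Bad"
      using F_props(2) by (rule disjoint_family_on_mono[rotated]) auto
    have "\<tau> ?m \<beta> * (\<Sum>a\<in>?Bad. real (card (snd a))) \<le> \<tau> (Suc ?m) \<beta> * card (body X)"
    proof (rule dense_mass_le[OF _ _ _ disj _ eX])
      show "finite ?Bad" using F_props(1) by simp
      show "finite (body X)" by (rule piece_node(5)[OF X(1)])
      show "snd a \<subseteq> body X" if "a \<in> ?Bad" for a using that F_props(5) by auto
      show "\<tau> ?m \<beta> * card (body Z) * card (snd a) \<le> edges (body Z) (snd a)" if "a \<in> ?Bad" for a
        using that G by (auto simp: \<beta>_def)
      show "card (body Z) > 0" by (rule piece_node(6)[OF Z(1)])
    qed
    then have "\<tau> ?m \<beta> * (\<Sum>a\<in>?Bad. real (card (snd a))) \<le> \<tau> ?m \<beta> * (card (body X) * (\<delta> * \<xi> ^ \<beta>))"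
      by (simp add: \<tau>_Suc mult_ac)
    then have "(\<Sum>a\<in>?Bad. real (card (snd a))) \<le> card (body X) * (\<delta> * \<xi> ^ \<beta>)"
      using \<tau>_pos mult_le_cancel_left_pos by blast
    then show ?thesis using G by (auto simp: \<beta>_def)
  qed
  then obtain G where G: "G \<in> {G \<in> \<sigma>. covers G x \<and> depth G \<le> b}"
    "(\<Sum>a\<in>?Bad. real (card (snd a))) \<le> card (body X) * (\<delta> * \<xi> ^ (b - depth G))" by auto
  \<comment> \<open>Summing over all candidates makes the bound independent of which
    \<open>G\<close> was found.\<close>
  have "\<delta> * \<xi> ^ (b - depth G) \<le> (\<Sum>G | G \<in> \<sigma> \<and> covers G x \<and> depth G \<le> b. \<delta> * \<xi> ^ (b - depth G))"
    using G(1) finite_assignment \<xi> \<delta>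
    by (intro member_le_sum[where f = "\<lambda>G. \<delta> * \<xi> ^ (b - depth G)"]) auto
  then have "card (body X) * (\<delta> * \<xi> ^ (b - depth G))
      \<le> card (body X) * (\<Sum>G | G \<in> \<sigma> \<and> covers G x \<and> depth G \<le> b. \<delta> * \<xi> ^ (b - depth G))"
    by (intro mult_left_mono) auto
  then show ?thesis using G(2) by linarith
qed

text \<open>Pieces deeper than \<open>N\<close> are discarded, so \<open>N\<close> is tested only
  against \<open>Z\<close> with \<open>depth Z \<le> fst a\<close>, as in \<open>bad_mass\<close>.
  Parents and witnesses \<open>G\<close> survive the truncation, being no deeper than the pieces
  they serve.\<close>

lemma valid_insert:
  assumes x: "covers X x" and uncovered: "\<And>P. P \<in> \<sigma> \<Longrightarrow> rank P = r \<Longrightarrow> \<not> covers P x"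
    and a: "a \<in> F" and unused: "\<And>P. P \<in> \<sigma> \<Longrightarrow> rank P = r \<Longrightarrow> body P \<inter> snd a = {}"
    and good: "\<And>b Z. Z \<in> \<sigma> \<Longrightarrow> covers Z (flip b x) \<Longrightarrow> b < depth Z \<Longrightarrow> depth Z \<le> fst a \<Longrightarrow>
      \<exists>G\<in>\<sigma>. depth G \<le> b \<and> covers G x \<and>
        edges (body Z) (snd a) \<le> \<tau> (r + rank Z) (b - depth G) * card (body Z) * card (snd a)"
  defines "N \<equiv> Piece (fst a) (x \<inter> {..<fst a}) r (snd a)"
  shows "valid (insert N {P \<in> \<sigma>. depth P \<le> depth N})"
proof -
  have N: "depth N = fst a" "rank N = r" "body N = snd a" "prefix N = x \<inter> {..<fst a}"
    by (auto simp: N_def)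
  have Nx: "x \<inter> {..<fst a} = y \<inter> {..<fst a}" if "covers N y" for y
    using that by (simp add: covers_def N)
  have nodeN: "node r (fst a) (snd a)" by (rule F_props(6)[OF a])
  let ?\<sigma> = "{P \<in> \<sigma>. depth P \<le> depth N}"
  have parents: "\<exists>Q\<in>?\<sigma>. rank Q = Suc (rank P) \<and> covers Q (prefix P) \<and>
      (depth P, body P) \<in> split (rank P) (depth Q) (body Q)" if P': "P \<in> ?\<sigma>" "P \<noteq> root" for P
  proof -
    have P: "P \<in> \<sigma>" "depth P \<le> depth N" using P' by auto
    obtain Q where Q: "Q \<in> \<sigma>" "rank Q = Suc (rank P)" "covers Q (prefix P)"
      "(depth P, body P) \<in> split (rank P) (depth Q) (body Q)"
      using parent_all P P'(2) by blast
    have "is_split (rank P) (depth Q) (body Q) (split (rank P) (depth Q) (body Q))"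
      using is_split_split piece_node(1)[OF Q(1)] Q(2) by simp
    then have "depth Q \<le> depth P"
      using Q(4) unfolding is_split_def by force
    then show ?thesis using P Q by (intro bexI[of _ Q]) auto
  qed
  have XN: "X \<in> ?\<sigma>" "covers X (prefix N)"
  proof -
    have "depth X \<le> fst a" by (rule F_props(4)[OF a])
    then show "X \<in> ?\<sigma>" using X by (simp add: N)
    have "x \<inter> {..<fst a} = prefix N \<inter> {..<fst a}" by (auto simp: N)
    from covers_cong[OF this \<open>depth X \<le> fst a\<close>] x show "covers X (prefix N)" by simp
  qed
  have new_old: "body P \<inter> body N = {} \<and> (\<forall>y. \<not> (covers P y \<and> covers N y))"
    if "P \<in> ?\<sigma>" "rank P = r" for P
  proof (intro conjI allI notI)
    show "body P \<inter> body N = {}" using unused[of P] that by (simp add: N)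
    fix y assume "covers P y \<and> covers N y"
    then have "covers P x" using covers_cong[of x "fst a" y P] Nx that by (auto simp: N)
    then show False using uncovered that by auto
  qed
  have sparse_new: "\<exists>G\<in>?\<sigma>. depth G \<le> b \<and> covers G y \<and> sparse (r + rank Q) (b - depth G) N Q
        \<and> sparse (r + rank Q) (b - depth G) Q N"
    if Q: "Q \<in> ?\<sigma>" and y: "covers N y" "covers Q (flip b y)" "b < depth N" "b < depth Q" for Q b y
  proof -
    \<comment> \<open>A piece no deeper than \<open>N\<close> cannot distinguish \<open>x\<close>
      from another point \<open>y\<close> of the subcube of \<open>N\<close>.\<close>
    have "covers Q (flip b x)"
      using covers_cong[OF flip_cong[OF Nx[OF y(1)]], of Q b] Q y(2) by (simp add: N)
    then obtain G where G: "G \<in> \<sigma>" "depth G \<le> b" "covers G x"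
      "edges (body Q) (snd a) \<le> \<tau> (r + rank Q) (b - depth G) * card (body Q) * card (snd a)"
      using good[of Q b] Q y by (auto simp: N)
    have "covers G y" using covers_cong[OF Nx[OF y(1)], of G] G y(3) by (simp add: N)
    moreover have "edges (body Q) (snd a) = edges (snd a) (body Q)"
      using Q piece_node(5) node_finite[OF nodeN] by (intro edges_sym) auto
    ultimately show ?thesis using G y(3) by (intro bexI[of _ G]) (auto simp: sparse_def N mult_ac)
  qed
  have old: "\<exists>G\<in>?\<sigma>. depth G \<le> b \<and> covers G y \<and> sparse (rank P + rank Q) (b - depth G) P Q"
    if PQ: "P \<in> ?\<sigma>" "Q \<in> ?\<sigma>" "covers P y" "covers Q (flip b y)" "b < depth P" "b < depth Q" for P Q b y
  proof -
    have "P \<in> \<sigma>" "Q \<in> \<sigma>" using that by auto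
    obtain G where "G \<in> \<sigma>" "depth G \<le> b" "covers G y" "sparse (rank P + rank Q) (b - depth G) P Q"
      by (rule piece_sparse[OF \<open>P \<in> \<sigma>\<close> \<open>Q \<in> \<sigma>\<close> PQ(3-6)])
    then show ?thesis using PQ by (intro bexI[of _ G]) auto
  qed
  show ?thesis
    unfolding valid_def
  proof (intro conjI)
    show "finite (insert N ?\<sigma>)" using finite_assignment by simp
    show "root \<in> insert N ?\<sigma>" using root_in by (simp add: root_def)
    show "\<forall>P\<in>insert N ?\<sigma>. node (rank P) (depth P) (body P) \<and> rank P \<le> R \<and> prefix P \<subseteq> {..<depth P}"
      using piece_node nodeN r_less by (auto simp: N)
    show "\<forall>P\<in>insert N ?\<sigma>. P = root \<or> (\<exists>Q\<in>insert N ?\<sigma>. rank Q = Suc (rank P) \<and>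
        covers Q (prefix P) \<and> (depth P, body P) \<in> split (rank P) (depth Q) (body Q))"
    proof
      fix P assume "P \<in> insert N ?\<sigma>"
      moreover have "(depth N, body N) \<in> split (rank N) (depth X) (body X)"
        using a F_def by (simp add: N)
      then have "\<exists>Q\<in>insert N ?\<sigma>. rank Q = Suc (rank N) \<and>
        covers Q (prefix N) \<and> (depth N, body N) \<in> split (rank N) (depth Q) (body Q)"
        using XN X(2) N(2) by (intro bexI[of _ X]) auto
      ultimately show "P = root \<or> (\<exists>Q\<in>insert N ?\<sigma>. rank Q = Suc (rank P) \<and>
        covers Q (prefix P) \<and> (depth P, body P) \<in> split (rank P) (depth Q) (body Q))"
        using parents[of P] by blast
    qed
    show "\<forall>P\<in>insert N ?\<sigma>. \<forall>Q\<in>insert N ?\<sigma>. rank P = rank Q \<longrightarrow>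
        P = Q \<or> body P \<inter> body Q = {} \<and> (\<forall>x. \<not> (covers P x \<and> covers Q x))"
    proof (intro ballI impI)
      fix P Q assume PQ: "P \<in> insert N ?\<sigma>" "Q \<in> insert N ?\<sigma>" "rank P = rank Q"
      show "P = Q \<or> body P \<inter> body Q = {} \<and> (\<forall>x. \<not> (covers P x \<and> covers Q x))"
      proof (cases "P = N \<or> Q = N")
        case True
        then show ?thesis using PQ new_old[of P] new_old[of Q] N(2) by (auto simp: Int_commute)
      next
        case False
        then show ?thesis using PQ piece_unique[of P Q] by auto
      qed
    qed
    show "\<forall>P\<in>insert N ?\<sigma>. \<forall>Q\<in>insert N ?\<sigma>. \<forall>b x. covers P x \<longrightarrow> covers Q (flip b x) \<longrightarrow>
        b < depth P \<longrightarrow> b < depth Q \<longrightarrow>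
        (\<exists>G\<in>insert N ?\<sigma>. depth G \<le> b \<and> covers G x \<and> sparse (rank P + rank Q) (b - depth G) P Q)"
    proof (intro ballI allI impI)
      fix P Q b y
      assume PQ: "P \<in> insert N ?\<sigma>" "Q \<in> insert N ?\<sigma>" "covers P y" "covers Q (flip b y)"
        "b < depth P" "b < depth Q"
      have "\<exists>G\<in>?\<sigma>. depth G \<le> b \<and> covers G y \<and> sparse (rank P + rank Q) (b - depth G) P Q"
      proof (cases "P = N")
        case True
        then have "Q \<noteq> N" using PQ not_covers_flip by blast
        then show ?thesis using sparse_new[of Q y b] PQ True N(2) by auto
      next
        case P: False
        show ?thesis
        proof (cases "Q = N")
          \<comment> \<open>The roles are exchanged by replacing \<open>y\<close> with
            \<open>flip b y\<close>; \<open>G\<close> covers both.\<close>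
          case True
          then obtain G where "G \<in> ?\<sigma>" "depth G \<le> b" "covers G (flip b y)"
            "sparse (r + rank P) (b - depth G) P Q"
            using sparse_new[of P "flip b y" b] PQ P by auto
          then show ?thesis
            using covers_flip[of G b y] True N(2) by (intro bexI[of _ G]) (auto simp: add.commute)
        next
          case False
          then show ?thesis using old[of P Q y b] PQ P by auto
        qed
      qed
      then show "\<exists>G\<in>insert N ?\<sigma>. depth G \<le> b \<and> covers G y \<and> sparse (rank P + rank Q) (b - depth G) P Q"
        by blast
    qed
  qed
qed

end

end

end

section \<open>Maximal assignments cover every vertex of the cube\<close>

lemma sum_le_cover:
  fixes f :: "'b \<Rightarrow> real"
  assumes "finite I" "finite A" "\<And>i. i \<in> I \<Longrightarrow> finite (B i)" "\<And>a. f a \<ge> 0"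
    and "F \<subseteq> A \<union> (\<Union>i\<in>I. B i)"
  shows "sum f F \<le> sum f A + (\<Sum>i\<in>I. sum f (B i))"
proof -
  have Un: "sum f (S \<union> T) \<le> sum f S + sum f T" if "finite S" "finite T" for S T
    using sum.union_inter[OF that, of f] sum_nonneg[of "S \<inter> T" f] assms(4) by simp
  have fin: "finite (\<Union>i\<in>I. B i)" using assms by blast
  have "sum f F \<le> sum f (A \<union> (\<Union>i\<in>I. B i))"
    using assms fin by (intro sum_mono2) auto
  also have "\<dots> \<le> sum f A + sum f (\<Union>i\<in>I. B i)" using Un assms(2) fin by blast
  also have "sum f (\<Union>i\<in>I. B i) \<le> (\<Sum>i\<in>I. sum f (B i))"
    using assms(1,3)
  proof (induction I rule: finite_induct)
    case (insert i I)
    have "sum f (\<Union>i\<in>insert i I. B i) \<le> sum f (B i) + sum f (\<Union>i\<in>I. B i)"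
      using Un[of "B i" "\<Union>i\<in>I. B i"] insert by auto
    also have "\<dots> \<le> sum f (B i) + (\<Sum>i\<in>I. sum f (B i))" using insert by auto
    finally show ?case using insert by simp
  qed simp
  finally show ?thesis by simp
qed

lemma sum_shifted_geometric_le:
  fixes q :: real
  assumes "0 < q" "q < 1"
  shows "(\<Sum>b\<in>{d..<n}. q ^ (b - d)) \<le> 1 / (1 - q)"
proof -
  have "(\<Sum>b\<in>{d..<n}. q ^ (b - d)) = (\<Sum>i<n - d. q ^ i)"
    by (rule sum.reindex_bij_witness[where i = "\<lambda>i. i + d" and j = "\<lambda>b. b - d"]) auto
  also have "\<dots> \<le> (\<Sum>i. q ^ i)"
    using assms by (intro sum_le_suminf summable_geometric) auto
  also have "\<dots> = 1 / (1 - q)" using assms by (intro suminf_geometric) auto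
  finally show ?thesis .
qed

context cube_embedding
begin

lemma valid_root: "valid {root}"
  using node_V by (auto simp: valid_def root_def)

text \<open>The pieces in question form a finite set, so \<open>greedy_family\<close> applies with
  \<open>depth\<close> as weight: large subcubes take precedence.\<close>

lemma greedy_assignment_exists:
  "\<exists>\<sigma>. valid \<sigma> \<and> (\<forall>N. N \<notin> \<sigma> \<longrightarrow> depth N \<le> n \<longrightarrow> prefix N \<subseteq> {..<n} \<longrightarrow> rank N \<le> R \<longrightarrow>
     body N \<subseteq> V \<longrightarrow> \<not> valid (insert N {P \<in> \<sigma>. depth P \<le> depth N}))"
proof -
  define U where "U = (\<lambda>(d, p, r, X). Piece d p r X) ` ({..n} \<times> Pow {..<n} \<times> {..R} \<times> Pow V)"
  have mem: "N \<in> U" if "depth N \<le> n" "prefix N \<subseteq> {..<n}" "rank N \<le> R" "body N \<subseteq> V" for N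
    using that unfolding U_def by (intro image_eqI[of _ _ "(depth N, prefix N, rank N, body N)"]) auto
  have "finite U" "{root} \<subseteq> U" "valid {root}"
    using finite_V mem[of root] valid_root by (auto simp: U_def root_def)
  from greedy_family[where P = valid and w = depth, OF this] mem show ?thesis by blast
qed

text \<open>Induction from rank \<open>R\<close> downwards. If \<open>X\<close> covers
  \<open>x\<close> but no piece of the next rank does, then by maximality and
  \<open>valid_insert\<close> every child of \<open>X\<close> is used or excluded, which the two
  mass bounds make impossible.\<close>

lemma vertices_covered:
  assumes valid: "valid \<sigma>"
    and max: "\<And>N. N \<notin> \<sigma> \<Longrightarrow> depth N \<le> n \<Longrightarrow> prefix N \<subseteq> {..<n} \<Longrightarrow> rank N \<le> R \<Longrightarrow>
      body N \<subseteq> V \<Longrightarrow> \<not> valid (insert N {P \<in> \<sigma>. depth P \<le> depth N})"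
    and x: "x \<subseteq> {..<n}" and k: "k \<le> R"
  shows "\<exists>P\<in>\<sigma>. rank P = k \<and> covers P x"
  using k
proof (induction k rule: inc_induct)
  case base
  show ?case
    using root_in[OF valid] by (intro bexI[of _ root]) (auto simp: root_def covers_def)
next
  case (step k)
  then obtain X where X: "X \<in> \<sigma>" "rank X = Suc k" "covers X x" by auto
  show ?case
  proof (rule ccontr)
    assume "\<not> ?case"
    then have uncovered: "\<And>P. P \<in> \<sigma> \<Longrightarrow> rank P = k \<Longrightarrow> \<not> covers P x" by blast
    define F where "F = split k (depth X) (body X)"
    note props = F_props[OF valid X(1,2) F_def]
    define Used where "Used = {a \<in> F. \<exists>P\<in>\<sigma>. rank P = k \<and> body P \<inter> snd a \<noteq> {}}"
    define Bad where "Bad b Z = {a \<in> F. depth Z \<le> fst a \<and> (\<forall>G\<in>\<sigma>. depth G \<le> b \<longrightarrow> covers G x \<longrightarrow>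
        \<tau> (k + rank Z) (b - depth G) * card (body Z) * card (snd a) \<le> edges (body Z) (snd a))}" for b Z
    define I where "I = Sigma {..<n} (\<lambda>b. {Z \<in> \<sigma>. covers Z (flip b x) \<and> b < depth Z})"
    define C where "C = {G \<in> \<sigma>. covers G x}"
    let ?m = "\<lambda>a :: nat \<times> 'a set. real (card (snd a))"
    have fin: "finite \<sigma>" "finite I" "finite Used" "finite C" "finite F"
      using finite_assignment[OF valid] props(1) by (auto simp: I_def Used_def C_def)
    have "F \<subseteq> Used \<union> (\<Union>(b, Z)\<in>I. Bad b Z)"
    proof
      fix a assume a: "a \<in> F"
      let ?N = "Piece (fst a) (x \<inter> {..<fst a}) k (snd a)"
      have "?N \<notin> \<sigma>" using uncovered[of ?N] by (auto simp: covers_def)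
      then have "\<not> valid (insert ?N {P \<in> \<sigma>. depth P \<le> depth ?N})"
        using max[of ?N] props(6)[OF a] x step.hyps by (auto simp: node_def)
      then have "\<not> ((\<forall>P. P \<in> \<sigma> \<longrightarrow> rank P = k \<longrightarrow> body P \<inter> snd a = {}) \<and>
        (\<forall>b Z. Z \<in> \<sigma> \<longrightarrow> covers Z (flip b x) \<longrightarrow> b < depth Z \<longrightarrow> depth Z \<le> fst a \<longrightarrow>
          (\<exists>G\<in>\<sigma>. depth G \<le> b \<and> covers G x \<and>
          edges (body Z) (snd a) \<le> \<tau> (k + rank Z) (b - depth G) * card (body Z) * card (snd a))))"
        using valid_insert[OF valid X(1,2) F_def X(3) uncovered a] by blast
      then consider (used) P where "P \<in> \<sigma>" "rank P = k" "body P \<inter> snd a \<noteq> {}"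
        | (bad) b Z where "Z \<in> \<sigma>" "covers Z (flip b x)" "b < depth Z" "depth Z \<le> fst a"
          "\<And>G. G \<in> \<sigma> \<Longrightarrow> depth G \<le> b \<Longrightarrow> covers G x \<Longrightarrow>
            \<not> edges (body Z) (snd a) \<le> \<tau> (k + rank Z) (b - depth G) * card (body Z) * card (snd a)"
        by blast
      then show "a \<in> Used \<union> (\<Union>(b, Z)\<in>I. Bad b Z)"
      proof cases
        case used
        then show ?thesis using a by (auto simp: Used_def)
      next
        case bad
        have "b < n" using bad(3) piece_node(4)[OF valid bad(1)] by simp
        then have "(b, Z) \<in> I" using bad by (auto simp: I_def)
        moreover have "a \<in> Bad b Z" using bad(4,5) a by (auto simp: Bad_def not_le intro: less_imp_le)
        ultimately show ?thesis by blast
      qed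
    qed
    then have "sum ?m F \<le> sum ?m Used + (\<Sum>i\<in>I. sum ?m (case i of (b, Z) \<Rightarrow> Bad b Z))"
      using fin by (intro sum_le_cover) (auto simp: Bad_def)
    also have "(\<Sum>i\<in>I. sum ?m (case i of (b, Z) \<Rightarrow> Bad b Z))
        \<le> (\<Sum>(b, Z)\<in>I. card (body X) * (\<Sum>G | G \<in> C \<and> depth G \<le> b. \<delta> * \<xi> ^ (b - depth G)))"
    proof (intro sum_mono)
      fix i assume i: "i \<in> I"
      obtain b Z where bZ: "i = (b, Z)" by (cases i)
      have "sum ?m (Bad b Z) \<le> card (body X) * (\<Sum>G | G \<in> \<sigma> \<and> covers G x \<and> depth G \<le> b. \<delta> * \<xi> ^ (b - depth G))"
        unfolding Bad_def using i bZ
        by (intro bad_mass[OF valid X(1,2) F_def X(3) uncovered]) (auto simp: I_def)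
      then show "sum ?m (case i of (b, Z) \<Rightarrow> Bad b Z) \<le>
          (case i of (b, Z) \<Rightarrow> card (body X) * (\<Sum>G | G \<in> C \<and> depth G \<le> b. \<delta> * \<xi> ^ (b - depth G)))"
        by (simp add: bZ C_def conj_assoc)
    qed
    also have "\<dots> = (\<Sum>b<n. card {Z \<in> \<sigma>. covers Z (flip b x) \<and> b < depth Z} *
        (card (body X) * (\<Sum>G | G \<in> C \<and> depth G \<le> b. \<delta> * \<xi> ^ (b - depth G))))"
      unfolding I_def using fin(1) by (subst sum.Sigma[symmetric]) auto
    also have "\<dots> \<le> (\<Sum>b<n. (R + 1) *
        (card (body X) * (\<Sum>G | G \<in> C \<and> depth G \<le> b. \<delta> * \<xi> ^ (b - depth G))))"
    proof (intro sum_mono mult_right_mono)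
      fix b
      have "card {Z \<in> \<sigma>. covers Z (flip b x) \<and> b < depth Z} \<le> card {Z \<in> \<sigma>. covers Z (flip b x)}"
        using fin(1) by (intro card_mono) auto
      also have "\<dots> \<le> R + 1" by (rule card_chain[OF valid])
      finally show "real (card {Z \<in> \<sigma>. covers Z (flip b x) \<and> b < depth Z}) \<le> real (R + 1)"
        by (rule of_nat_mono)
      show "0 \<le> card (body X) * (\<Sum>G | G \<in> C \<and> depth G \<le> b. \<delta> * \<xi> ^ (b - depth G))"
        using \<xi> \<delta> by (intro mult_nonneg_nonneg sum_nonneg) auto
    qed
    also have "\<dots> = real (R + 1) * real (card (body X)) * \<delta> * (\<Sum>b<n. \<Sum>G | G \<in> C \<and> depth G \<le> b. \<xi> ^ (b - depth G))"
      by (simp only: sum_distrib_left mult_ac)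
    \<comment> \<open>After the exchange, each \<open>G\<close> contributes a geometric series in
      the distance \<open>b - depth G\<close>, so the bound does not depend on
      \<open>n\<close>.\<close>
    also have "(\<Sum>b<n. \<Sum>G | G \<in> C \<and> depth G \<le> b. \<xi> ^ (b - depth G)) = (\<Sum>G\<in>C. \<Sum>b | b \<in> {..<n} \<and> depth G \<le> b. \<xi> ^ (b - depth G))"
      using fin(4) by (intro sum.swap_restrict) auto
    also have "\<dots> \<le> (\<Sum>G\<in>C. 1 / (1 - \<xi>))"
    proof (intro sum_mono)
      fix G
      have "{b. b \<in> {..<n} \<and> depth G \<le> b} = {depth G..<n}" by auto
      then show "(\<Sum>b | b \<in> {..<n} \<and> depth G \<le> b. \<xi> ^ (b - depth G)) \<le> 1 / (1 - \<xi>)"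
        using sum_shifted_geometric_le[OF \<xi>(1,2)] by simp
    qed
    also have "\<dots> = card C / (1 - \<xi>)" by simp
    also have "\<dots> \<le> real (R + 1) / (1 - \<xi>)"
      using card_chain[OF valid, of x] \<xi> unfolding C_def
      by (intro divide_right_mono of_nat_mono) auto
    also have "real (R + 1) * real (card (body X)) * \<delta> * (real (R + 1) / (1 - \<xi>))
        = card (body X) * ((R + 1)\<^sup>2 * \<delta> / (1 - \<xi>))"
      by (simp add: power2_eq_square add_divide_distrib algebra_simps)
    also have "\<dots> \<le> card (body X) * (1 / 4)"
      using \<delta>(3) \<xi>(2) by (intro mult_left_mono) (auto simp: field_simps)
    also have "sum ?m Used \<le> card (body X) / 8"
    proof -
      have "8 * (\<Sum>a\<in>Used. card (snd a)) \<le> 8 * (K k * 2 ^ (n - depth X))"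
        using used_mass[OF valid X(1,2) F_def] unfolding Used_def by simp
      also have "\<dots> \<le> K (Suc k) * 2 ^ (n - depth X)"
        using K_step(1)[of k] step.hyps by simp
      also have "\<dots> = card (body X)"
        using piece_node(1)[OF valid X(1)] X(2) by (simp add: node_def)
      finally have "real (8 * (\<Sum>a\<in>Used. card (snd a))) \<le> card (body X)"
        by (rule of_nat_mono)
      then show ?thesis by simp
    qed
    finally have "sum ?m F \<le> card (body X) / 8 + card (body X) * (1 / 4)"
      using \<delta>(1) by (simp add: mult_left_mono)
    \<comment> \<open>The children make up at least half of \<open>X\<close>, but 1/8 + 1/4 <
      1/2.\<close>
    moreover have "real (card (body X)) \<le> 2 * sum ?m F"
      using of_nat_mono[OF props(3), where 'a = real] by simp
    moreover have "card (body X) > 0" by (rule piece_node(6)[OF valid X(1)])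
    ultimately show False by simp
  qed
qed

text \<open>Pieces of rank 0 have depth \<open>n\<close> and singleton bodies, so they assign a
  vertex of \<open>V\<close> to each vertex of the cube; disjointness of bodies gives
  injectivity.\<close>

theorem cube_embeds:
  "\<exists>f. inj_on f (Pow {..<n}) \<and> f ` Pow {..<n} \<subseteq> V \<and>
     (\<forall>x\<in>Pow {..<n}. \<forall>b<n. \<not> blue (f x) (f (flip b x)))"
proof -
  obtain \<sigma> where valid: "valid \<sigma>" and max: "\<forall>N. N \<notin> \<sigma> \<longrightarrow> depth N \<le> n \<longrightarrow>
      prefix N \<subseteq> {..<n} \<longrightarrow> rank N \<le> R \<longrightarrow> body N \<subseteq> V \<longrightarrow>
      \<not> valid (insert N {P \<in> \<sigma>. depth P \<le> depth N})"
    using greedy_assignment_exists by blast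
  have "\<exists>P\<in>\<sigma>. rank P = 0 \<and> covers P x" if "x \<subseteq> {..<n}" for x
    using vertices_covered[OF valid _ that, of 0] max by blast
  then obtain p where p: "\<And>x. x \<subseteq> {..<n} \<Longrightarrow> p x \<in> \<sigma> \<and> rank (p x) = 0 \<and> covers (p x) x"
    by metis
  have depth: "depth (p x) = n" and body: "\<exists>v. body (p x) = {v}" if "x \<subseteq> {..<n}" for x
    using piece_node(1)[OF valid, of "p x"] p[OF that] K_0 by (auto simp: node_def card_1_singleton_iff)
  then obtain f where f: "\<And>x. x \<subseteq> {..<n} \<Longrightarrow> body (p x) = {f x}" by metis
  have inV: "f x \<in> V" if "x \<subseteq> {..<n}" for x
    using piece_node(1)[OF valid, of "p x"] p[OF that] f[OF that] by (auto simp: node_def)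
  have "inj_on f (Pow {..<n})"
  proof (rule inj_onI)
    fix x y assume xy: "x \<in> Pow {..<n}" "y \<in> Pow {..<n}" "f x = f y"
    then have "p x = p y"
      using piece_unique(2)[OF valid, of "p x" "p y"] p[of x] p[of y] f[of x] f[of y] by auto
    then show "x = y"
      using xy p[of x] p[of y] depth[of x] by (auto simp: covers_def Int_absorb2)
  qed
  moreover have "\<not> blue (f x) (f (flip b x))" if x: "x \<subseteq> {..<n}" and b: "b < n" for x b
  proof
    assume blue: "blue (f x) (f (flip b x))"
    let ?y = "flip b x"
    have y: "?y \<subseteq> {..<n}" using flip_subset x b by blast
    have *: "p x \<in> \<sigma>" "p ?y \<in> \<sigma>" "covers (p x) x" "covers (p ?y) ?y" "b < depth (p x)" "b < depth (p ?y)"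
      using p[OF x] p[OF y] depth[OF x] depth[OF y] b by auto
    obtain G where "G \<in> \<sigma>" "depth G \<le> b" "covers G x"
      "sparse (rank (p x) + rank (p ?y)) (b - depth G) (p x) (p ?y)"
      by (rule piece_sparse[OF valid *])
    \<comment> \<open>Both ranks are 0, so the density bound is \<open>\<tau> 0 _ = 1 / 2\<close>,
      while a blue edge would give density 1.\<close>
    then have "edges {f x} {f ?y} \<le> (1 / 2 :: real)"
      using p[OF x] p[OF y] f[OF x] f[OF y] by (simp add: sparse_def \<tau>_def)
    moreover have "{v \<in> {f ?y}. blue (f x) v} = {f ?y}" using blue by auto
    ultimately show False by (simp add: edges_def)
  qed
  ultimately show ?thesis using inV by (intro exI[of _ f]) auto
qed

end

section \<open>Ramsey numbers, choice of constants and the final bound\<close>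

lemma ramsey_numbers_exist:
  "\<exists>rn. \<forall>m k. \<forall>(X :: nat set) E. finite X \<and> rn m k \<le> card X \<longrightarrow>
     (\<exists>Y\<subseteq>X. card Y = m \<and> clique Y E \<or> card Y = k \<and> indep Y E)"
proof -
  have "\<forall>m k. \<exists>r. \<forall>(X :: nat set) E. finite X \<and> r \<le> card X \<longrightarrow>
     (\<exists>Y\<subseteq>X. card Y = m \<and> clique Y E \<or> card Y = k \<and> indep Y E)"
    using ramsey2 by meson
  then show ?thesis by metis
qed

text \<open>In the recursion for \<open>K\<close>, the factor \<open>A\<close> meets the linear
  demands and the summand \<open>2 * h r k\<close> the last one; \<open>h\<close> will be a Ramsey
  number.\<close>

lemma growth_sequence_exists:
  fixes \<epsilon> :: real and h :: "nat \<Rightarrow> nat \<Rightarrow> nat"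
  assumes "\<epsilon> > 0"
  shows "\<exists>K :: nat \<Rightarrow> nat. K 0 = 1 \<and> (\<forall>r. K r > 0 \<and> 8 * K r \<le> K (Suc r) \<and>
    2 * K r \<le> \<epsilon> * K (Suc r) \<and> 2 * h r (K r) \<le> K (Suc r))"
proof -
  define A where "A = 8 + nat \<lceil>2 / \<epsilon>\<rceil>"
  define K :: "nat \<Rightarrow> nat" where "K = rec_nat 1 (\<lambda>r k. A * k + 2 * h r k)"
  have K: "K 0 = 1" "K (Suc r) = A * K r + 2 * h r (K r)" for r by (simp_all add: K_def)
  have "2 / \<epsilon> \<le> A" unfolding A_def by linarith
  then have A: "2 \<le> \<epsilon> * A" using assms by (simp add: field_simps)
  have "2 * K r \<le> \<epsilon> * K (Suc r)" for r
  proof -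
    have "2 * real (K r) \<le> \<epsilon> * A * K r" using A by (intro mult_right_mono) auto
    also have "\<dots> = \<epsilon> * (A * K r)" by simp
    also have "\<dots> \<le> \<epsilon> * K (Suc r)" using assms unfolding K(2) by (intro mult_left_mono) auto
    finally show ?thesis by simp
  qed
  moreover have "K r > 0" for r by (induction r) (auto simp: K A_def)
  moreover have "8 * K r \<le> K (Suc r)" for r by (simp add: K A_def algebra_simps)
  moreover have "2 * h r (K r) \<le> K (Suc r)" for r by (simp add: K)
  ultimately show ?thesis using K(1) by blast
qed

lemma cube_adj_flip:
  assumes "cube_adj A B" "A \<subseteq> {..<n}" "B \<subseteq> {..<n}"
  shows "\<exists>b<n. B = flip b A"
proof -
  obtain b where b: "(A - B) \<union> (B - A) = {b}"
    using assms(1) by (auto simp: cube_adj_def card_1_singleton_iff)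
  then have "b < n" using assms(2,3) by auto
  moreover have "B = flip b A" using b unfolding flip_def by blast
  ultimately show ?thesis by blast
qed

theorem theorem1:
  shows "\<forall>s::nat. s \<ge> 3 \<longrightarrow>
           (\<exists>c::real. \<forall>n::nat. real (ramsey_cube_clique n s) \<le> c * 2 ^ n)"
proof (intro allI impI)
  fix s :: nat assume s: "s \<ge> 3"
  define R where "R = s - 1"
  \<comment> \<open>Bernoulli's inequality gives
    \<open>\<xi> ^ (2 * R) \<ge> 1 - 2 * R / (4 * R) = 1 / 2\<close>.\<close>
  define \<xi> :: real where "\<xi> = 1 - 1 / (4 * R)"
  define \<delta> :: real where "\<delta> = (1 - \<xi>) / (4 * (R + 1)\<^sup>2)"
  have R: "R \<ge> 2" "s = Suc R" using s by (auto simp: R_def)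
  have \<xi>: "0 < \<xi>" "\<xi> < 1" using R by (auto simp: \<xi>_def field_simps)
  have "1 + real (2 * R) * (- 1 / (4 * R)) \<le> (1 + (- 1 / (4 * R))) ^ (2 * R)"
    using R by (intro Bernoulli_inequality) (auto simp: field_simps)
  then have \<xi>_pow: "1 / 2 \<le> \<xi> ^ (2 * R)" using R by (simp add: \<xi>_def)
  have R_sq: "1 \<le> 4 * (real R + 1)\<^sup>2" by (simp add: power2_eq_square algebra_simps)
  have \<delta>_eq: "4 * (R + 1)\<^sup>2 * \<delta> = 1 - \<xi>" using R_sq by (simp add: \<delta>_def)
  have \<delta>_pos: "0 < \<delta>" using \<xi> by (simp add: \<delta>_def)
  have "1 * \<delta> \<le> 4 * (real R + 1)\<^sup>2 * \<delta>" using R_sq \<delta>_pos by (intro mult_right_mono) auto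
  then have "\<delta> \<le> 1" using \<delta>_eq \<xi> by (simp add: add.commute)
  then have \<delta>: "0 < \<delta>" "\<delta> \<le> 1" "4 * (R + 1)\<^sup>2 * \<delta> \<le> 1 - \<xi>" using \<delta>_eq \<delta>_pos by auto
  obtain rn where rn: "\<And>m k (X :: nat set) E. finite X \<Longrightarrow> rn m k \<le> card X \<Longrightarrow>
     (\<exists>Y\<subseteq>X. card Y = m \<and> clique Y E \<or> card Y = k \<and> indep Y E)"
    using ramsey_numbers_exist by metis
  obtain K :: "nat \<Rightarrow> nat" where K: "K 0 = 1" "\<And>r. K r > 0" "\<And>r. 8 * K r \<le> K (Suc r)"
    "\<And>r. 2 * K r \<le> \<delta> ^ (2 * R) * K (Suc r)" "\<And>r. 2 * rn (Suc (Suc r)) (K r) \<le> K (Suc r)"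
    using growth_sequence_exists[of "\<delta> ^ (2 * R)" "\<lambda>r. rn (Suc (Suc r))"] \<delta>(1) by auto
  \<comment> \<open>\<open>K\<close> was chosen before \<open>n\<close>, so \<open>K R\<close> can
    serve as the constant for \<open>s\<close>.\<close>
  have "ramsey_cube_clique n s \<le> K R * 2 ^ n" for n
    unfolding ramsey_cube_clique_def
  proof (intro Least_le allI impI)
    let ?N = "K R * 2 ^ n"
    fix E assume E: "simple_graph_on ?N E"
    \<comment> \<open>The bounds by \<open>?N\<close> are included because \<open>E\<close> is
      arbitrary outside the vertex set.\<close>
    define blue where "blue u v \<longleftrightarrow> u < ?N \<and> v < ?N \<and> u \<noteq> v \<and> \<not> E u v" for u v
    show "contains_cube ?N E n \<or> has_indep_set ?N E s"
    proof (rule disjCI)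
      assume no_indep: "\<not> has_indep_set ?N E s"
      interpret blue_graph "{..<?N}" blue
        using E by unfold_locales (auto simp: blue_def simple_graph_on_def)
      interpret node_sizes "{..<?N}" blue n K
      proof
        show "K 0 = 1" by (rule K(1))
        show "K r > 0" for r by (rule K(2))
        fix X r assume X: "X \<subseteq> {..<?N}" "clique_free (Suc (Suc r)) X" "K (Suc r) \<le> 2 * card X"
        let ?Es = "{{u, v} |u v. blue u v}"
        have mem: "{u, v} \<in> ?Es \<longleftrightarrow> blue u v" for u v
          using blue_sym by (auto simp: doubleton_eq_iff)
        have "finite X" "rn (Suc (Suc r)) (K r) \<le> card X"
          using X K(5)[of r] by (auto intro: finite_subset)
        from rn[OF this, of ?Es] obtain Y where Y: "Y \<subseteq> X"
          "card Y = Suc (Suc r) \<and> clique Y ?Es \<or> card Y = K r \<and> indep Y ?Es" by blast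
        moreover have "\<not> (card Y = Suc (Suc r) \<and> clique Y ?Es)"
          using X(2) Y(1) unfolding clique_free_def clique_def mem by blast
        ultimately have "card Y = K r" and indep: "indep Y ?Es" by blast+
        moreover have "\<forall>u\<in>Y. \<forall>v\<in>Y. \<not> blue u v"
        proof (intro ballI)
          fix u v assume "u \<in> Y" "v \<in> Y"
          then show "\<not> blue u v"
            using indep mem[of u v] blue_irrefl[of u] unfolding indep_def by (cases "u = v") simp_all
        qed
        ultimately show "\<exists>Y\<subseteq>X. card Y = K r \<and> (\<forall>u\<in>Y. \<forall>v\<in>Y. \<not> blue u v)" using Y(1) by blast
      qed
      have "clique_free (Suc R) {..<?N}"
        unfolding clique_free_def
      proof (intro notI, elim exE conjE)
        fix C assume C: "C \<subseteq> {..<?N}" "card C = Suc R" "\<forall>u\<in>C. \<forall>v\<in>C. u \<noteq> v \<longrightarrow> blue u v"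
        have "\<not> E u v" if "u \<in> C" "v \<in> C" for u v
        proof (cases "u = v")
          case True
          have "u < ?N" using C(1) that by blast
          then show ?thesis using E True by (simp add: simple_graph_on_def)
        next
          case False
          then show ?thesis using C(3) that by (simp add: blue_def)
        qed
        then have "C \<subseteq> {0..<?N} \<and> card C = s \<and> (\<forall>u\<in>C. \<forall>v\<in>C. \<not> E u v)"
          using C(1,2) R(2) by (simp add: atLeast0LessThan)
        then show False using no_indep unfolding has_indep_set_def by blast
      qed
      then have node: "node R 0 {..<?N}" using R by (simp add: node_def)
      interpret cube_embedding "{..<?N}" blue n K R \<delta> \<xi>
        by unfold_locales (rule \<xi> \<xi>_pow \<delta> K node)+
      obtain f where f: "inj_on f (Pow {..<n})" "f ` Pow {..<n} \<subseteq> {..<?N}"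
        "\<forall>x\<in>Pow {..<n}. \<forall>b<n. \<not> blue (f x) (f (flip b x))"
        using cube_embeds by blast
      have "E (f A) (f B)" if AB: "A \<subseteq> {..<n}" "B \<subseteq> {..<n}" "cube_adj A B" for A B
      proof -
        obtain b where b: "b < n" "B = flip b A" using cube_adj_flip AB by blast
        have "A \<noteq> B" using AB(3) by (auto simp: cube_adj_def)
        then have "f A \<noteq> f B" using f(1) AB by (auto dest: inj_onD)
        moreover have "f A < ?N" "f B < ?N" using f(2) AB by auto
        moreover have "\<not> blue (f A) (f B)" using f(3) AB b by auto
        ultimately show ?thesis by (simp add: blue_def)
      qed
      then show "contains_cube ?N E n"
        using f(1,2) unfolding contains_cube_def cube_vertices_def atLeast0LessThan
        by (intro exI[of _ f]) auto
    qed
  qed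
  then have "real (ramsey_cube_clique n s) \<le> real (K R) * 2 ^ n" for n
    by (metis of_nat_le_iff of_nat_mult of_nat_numeral of_nat_power)
  then show "\<exists>c::real. \<forall>n. real (ramsey_cube_clique n s) \<le> c * 2 ^ n" by blast
qed

end
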